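(* Let $k \ge 4$ and $\ell < \binom{k}{2}$ be integers, and let $G$ be a $(k-1)$-colorable $B+E_\ell$ graph, obtained from a bipartite graph by adding a set $E$ of $\ell$ edges. Suppose that every connected component of the graph formed by the edges of $E$ (with their endpoints) is a path, a cycle of length at least $4$, or a complete bipartite graph. Then $\mathrm{Kc}(G,k) = 1$.
   Context: All graphs are finite and simple. A $k$-coloring of a graph $G$ is a map $c: V(G) \to \{1,\dots,k\}$ with $c(u)\neq c(v)$ for every edge $uv$ (not all colors need be used); $G$ is $k$-colorable if it has one. For a colored graph and distinct colors $i,j$, $G(i,j)$ is the subgraph induced by the vertices colored $i$ or $j$; a Kempe change is the operation of swapping colors $i$ and $j$ on one connected component of $G(i,j)$. Two $k$-colorings are Kempe equivalent if one can be obtained from the other by a finite sequence of Kempe changes (possibly with different color pairs from $\{1,\dots,k\}$). $\mathrm{Kc}(G,k)$ is the number of Kempe equivalence classes of $k$-colorings of $G$. A $B+E_\ell$ graph is a graph obtained from a bipartite graph $B$ with partite sets $S$ and $T$ by adding $\ell$ new edges, each joining two vertices lying in the same partite set. *)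

theory Defs
  imports "HOL-Library.FuncSet" "HOL-Combinatorics.Transposition"
begin

record 'a graph =
  verts :: "'a set"
  edges :: "'a set set"

definition simple_graph :: "'a graph \<Rightarrow> bool" where
  "simple_graph G \<longleftrightarrow> finite (verts G) \<and>
     (\<forall>e\<in>edges G. \<exists>u\<in>verts G. \<exists>v\<in>verts G. u \<noteq> v \<and> e = {u, v})"

definition induced :: "'a graph \<Rightarrow> 'a set \<Rightarrow> 'a graph" where
  "induced G W = \<lparr>verts = verts G \<inter> W, edges = {e \<in> edges G. e \<subseteq> W}\<rparr>"

definition adj :: "'a graph \<Rightarrow> ('a \<times> 'a) set" where
  "adj G = {(u, v). u \<in> verts G \<and> v \<in> verts G \<and> {u, v} \<in> edges G}"

text \<open>Components are given by their vertex sets; the component as a graph is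
  the subgraph induced by this set.\<close>

definition components :: "'a graph \<Rightarrow> 'a set set" where
  "components G = {{w. (v, w) \<in> (adj G)\<^sup>*} | v. v \<in> verts G}"

text \<open>A colouring is taken to be \<open>undefined\<close> outside the vertex set, so that
  colourings of \<open>G\<close> are counted as maps with domain \<open>verts G\<close>.\<close>

definition colorings :: "'a graph \<Rightarrow> nat \<Rightarrow> ('a \<Rightarrow> nat) set" where
  "colorings G k = {c \<in> verts G \<rightarrow>\<^sub>E {1..k}. \<forall>u v. {u, v} \<in> edges G \<longrightarrow> c u \<noteq> c v}"

definition colorable :: "'a graph \<Rightarrow> nat \<Rightarrow> bool" where
  "colorable G k \<longleftrightarrow> colorings G k \<noteq> {}"

definition two_color_subgraph :: "'a graph \<Rightarrow> ('a \<Rightarrow> nat) \<Rightarrow> nat \<Rightarrow> nat \<Rightarrow> 'a graph" where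
  "two_color_subgraph G c i j = induced G {v \<in> verts G. c v \<in> {i, j}}"

definition kempe_change :: "'a graph \<Rightarrow> nat \<Rightarrow> ('a \<Rightarrow> nat) \<Rightarrow> ('a \<Rightarrow> nat) \<Rightarrow> bool" where
  "kempe_change G k c c' \<longleftrightarrow>
     (\<exists>i\<in>{1..k}. \<exists>j\<in>{1..k}. i \<noteq> j \<and>
       (\<exists>C\<in>components (two_color_subgraph G c i j).
          c' = (\<lambda>v. if v \<in> C then transpose i j (c v) else c v)))"

definition kempe_equivalence :: "'a graph \<Rightarrow> nat \<Rightarrow> (('a \<Rightarrow> nat) \<times> ('a \<Rightarrow> nat)) set" where
  "kempe_equivalence G k =
     {(c, c'). c \<in> colorings G k \<and> c' \<in> colorings G k \<and> (kempe_change G k)\<^sup>*\<^sup>* c c'}"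

definition Kc :: "'a graph \<Rightarrow> nat \<Rightarrow> nat" where
  "Kc G k = card (colorings G k // kempe_equivalence G k)"

definition bipartition :: "'a graph \<Rightarrow> 'a set \<Rightarrow> 'a set \<Rightarrow> bool" where
  "bipartition B S T \<longleftrightarrow> S \<union> T = verts B \<and> S \<inter> T = {} \<and>
     (\<forall>e\<in>edges B. \<exists>s\<in>S. \<exists>t\<in>T. e = {s, t})"

definition BE_graph ::
  "'a graph \<Rightarrow> 'a set \<Rightarrow> 'a set \<Rightarrow> 'a set set \<Rightarrow> nat \<Rightarrow> 'a graph \<Rightarrow> bool" where
  "BE_graph B S T E l G \<longleftrightarrow>
     simple_graph B \<and> bipartition B S T \<and>
     card E = l \<and> E \<inter> edges B = {} \<and>
     (\<forall>e\<in>E. \<exists>u v. u \<noteq> v \<and> e = {u, v} \<and> ({u, v} \<subseteq> S \<or> {u, v} \<subseteq> T)) \<and>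
     G = \<lparr>verts = verts B, edges = edges B \<union> E\<rparr>"

definition edge_graph :: "'a set set \<Rightarrow> 'a graph" where
  "edge_graph E = \<lparr>verts = \<Union>E, edges = E\<rparr>"

definition path_graph :: "'a graph \<Rightarrow> bool" where
  "path_graph H \<longleftrightarrow> (\<exists>p. p \<noteq> [] \<and> distinct p \<and> verts H = set p \<and>
     edges H = {{p ! i, p ! Suc i} | i. Suc i < length p})"

definition cycle_graph :: "nat \<Rightarrow> 'a graph \<Rightarrow> bool" where
  "cycle_graph n H \<longleftrightarrow> n \<ge> 3 \<and> (\<exists>p. length p = n \<and> distinct p \<and> verts H = set p \<and>
     edges H = {{p ! i, p ! (Suc i mod n)} | i. i < n})"

definition complete_bipartite :: "'a graph \<Rightarrow> bool" where
  "complete_bipartite H \<longleftrightarrow> (\<exists>X Y. X \<noteq> {} \<and> Y \<noteq> {} \<and> X \<inter> Y = {} \<and> verts H = X \<union> Y \<and>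
     edges H = {{x, y} | x y. x \<in> X \<and> y \<in> Y})"

lemma BE_graph_simple:
  assumes "BE_graph B S T E l G"
  shows "simple_graph G"
proof -
  have G: "G = \<lparr>verts = verts B, edges = edges B \<union> E\<rparr>" and B: "simple_graph B"
    and ST: "S \<subseteq> verts B" "T \<subseteq> verts B"
    and E: "\<forall>e\<in>E. \<exists>u v. u \<noteq> v \<and> e = {u, v} \<and> ({u, v} \<subseteq> S \<or> {u, v} \<subseteq> T)"
    using assms by (auto simp: BE_graph_def bipartition_def)
  have "\<exists>u\<in>verts B. \<exists>v\<in>verts B. u \<noteq> v \<and> e = {u, v}" if "e \<in> edges B \<union> E" for e
  proof (cases "e \<in> E")
    case True
    then obtain u v where uv: "u \<noteq> v" "e = {u, v}" "{u, v} \<subseteq> S \<or> {u, v} \<subseteq> T"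
      using E by meson
    then have "u \<in> verts B" "v \<in> verts B" using ST by auto
    with uv show ?thesis by blast
  next
    case False
    then show ?thesis using B that by (simp add: simple_graph_def)
  qed
  then show ?thesis using B unfolding G by (simp add: simple_graph_def)
qed

lemma adj_sym: "(u, v) \<in> adj G \<Longrightarrow> (v, u) \<in> adj G"
  by (auto simp: adj_def insert_commute)

lemma components_closed:
  assumes "C \<in> components G" "u \<in> C" "(u, v) \<in> adj G"
  shows "v \<in> C"
  using assms by (auto simp: components_def intro: rtrancl_into_rtrancl)

lemma components_subset:
  assumes "C \<in> components G"
  shows "C \<subseteq> verts G"
proof -
  obtain v where v: "v \<in> verts G" "C = {w. (v, w) \<in> (adj G)\<^sup>*}"
    using assms by (auto simp: components_def)
  have "w \<in> verts G" if "(v, w) \<in> (adj G)\<^sup>*" for w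
    using that v(1) by (induction rule: rtrancl_induct) (auto simp: adj_def)
  then show ?thesis using v by auto
qed

lemma kempe_change_colorings:
  assumes G: "simple_graph G" and c: "c \<in> colorings G k" and ch: "kempe_change G k c c'"
  shows "c' \<in> colorings G k"
proof -
  obtain i j C where ij: "i \<in> {1..k}" "j \<in> {1..k}" "i \<noteq> j"
    and C: "C \<in> components (two_color_subgraph G c i j)"
    and c': "c' = (\<lambda>v. if v \<in> C then transpose i j (c v) else c v)"
    using ch unfolding kempe_change_def by blast
  have V: "C \<subseteq> {v \<in> verts G. c v \<in> {i, j}}"
    using components_subset[OF C] by (simp add: two_color_subgraph_def induced_def)
  then have sub: "C \<subseteq> verts G" and sub2: "\<And>v. v \<in> C \<Longrightarrow> c v = i \<or> c v = j"
    by blast+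
  have cl: "v \<in> C" if "{u, v} \<in> edges G" "u \<in> C" "c v = i \<or> c v = j" for u v
  proof -
    have "\<exists>a\<in>verts G. \<exists>b\<in>verts G. a \<noteq> b \<and> {u, v} = {a, b}"
      using G that(1) by (simp add: simple_graph_def)
    then have "u \<in> verts G" "v \<in> verts G" by (auto simp: doubleton_eq_iff)
    then have "(u, v) \<in> adj (two_color_subgraph G c i j)"
      using that sub2[OF that(2)] by (auto simp: adj_def two_color_subgraph_def induced_def)
    then show ?thesis using components_closed[OF C that(2)] by blast
  qed
  have col: "c u \<noteq> c v" if "{u, v} \<in> edges G" for u v
    using c that by (auto simp: colorings_def)
  have "c' u \<noteq> c' v" if e: "{u, v} \<in> edges G" for u v
  proof -
    have e': "{v, u} \<in> edges G" using e by (simp add: insert_commute)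
    show ?thesis
      using col[OF e] cl[OF e] cl[OF e'] sub2[of u] sub2[of v]
      unfolding c' by (auto simp: transpose_def)
  qed
  moreover have "c' \<in> verts G \<rightarrow>\<^sub>E {1..k}"
    using c ij sub unfolding c' colorings_def
    by (auto simp: PiE_def Pi_def extensional_def transpose_def)
  ultimately show ?thesis by (auto simp: colorings_def)
qed

lemma kempe_change_sym:
  assumes "kempe_change G k c c'"
  shows "kempe_change G k c' c"
proof -
  obtain i j C where ij: "i \<in> {1..k}" "j \<in> {1..k}" "i \<noteq> j"
    and C: "C \<in> components (two_color_subgraph G c i j)"
    and c': "c' = (\<lambda>v. if v \<in> C then transpose i j (c v) else c v)"
    using assms unfolding kempe_change_def by blast
  have "c' v \<in> {i, j} \<longleftrightarrow> c v \<in> {i, j}" for v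
    unfolding c' by (auto simp: transpose_def split: if_splits)
  then have "two_color_subgraph G c' i j = two_color_subgraph G c i j"
    by (simp add: two_color_subgraph_def)
  moreover have "c = (\<lambda>v. if v \<in> C then transpose i j (c' v) else c' v)"
    unfolding c' by auto
  ultimately show ?thesis
    using ij C unfolding kempe_change_def by metis
qed

lemma kempe_equivalence_equiv: "equiv (colorings G k) (kempe_equivalence G k)"
proof -
  have s: "symp (kempe_change G k)\<^sup>*\<^sup>*"
    by (rule symp_rtranclp) (rule sympI, erule kempe_change_sym)
  show ?thesis
    unfolding equiv_def
  proof (intro conjI)
    show "kempe_equivalence G k \<subseteq> colorings G k \<times> colorings G k"
      by (auto simp: kempe_equivalence_def)
    show "refl_on (colorings G k) (kempe_equivalence G k)"
      by (simp add: refl_on_def kempe_equivalence_def)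
    show "sym (kempe_equivalence G k)"
    proof (rule symI)
      fix c d assume "(c, d) \<in> kempe_equivalence G k"
      then show "(d, c) \<in> kempe_equivalence G k"
        using sympD[OF s] by (simp add: kempe_equivalence_def)
    qed
    show "trans (kempe_equivalence G k)"
    proof (rule transI)
      fix c d e
      assume "(c, d) \<in> kempe_equivalence G k" "(d, e) \<in> kempe_equivalence G k"
      then show "(c, e) \<in> kempe_equivalence G k"
        unfolding kempe_equivalence_def using rtranclp_trans[of "kempe_change G k" c d e] by simp
    qed
  qed
qed

end

theory Submission
  imports Defs
begin

text \<open>
  Call a colour mixed if it is used both on \<open>S\<close> and on \<open>T\<close>. If no edge of \<open>E\<close> joins colours \<open>i\<close> and
  \<open>j\<close>, then the \<open>(i, j)\<close>-subgraph is bipartite with respect to \<open>(S, T)\<close> and Kempe changes push \<open>i\<close>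
  into \<open>S\<close> and \<open>j\<close> into \<open>T\<close>. Take a colouring in a given class with as few mixed colours as
  possible, and then as few vertices of mixed colour as possible, and suppose that some colour is
  mixed. Every two mixed colours, and every two colours that are pure on the same side, are joined by
  an edge of \<open>E\<close>, and each mixed vertex of \<open>S\<close> sees all colours that are pure on \<open>S\<close>.
  If two colours are pure on \<open>S\<close>, the structure of the components forces each mixed vertex of \<open>S\<close>
  onto an odd cycle that is otherwise coloured by these two, and this yields two surplus edges.
  Counting against \<open>\<ell> < k choose 2\<close> leaves one pure colour on each side and exactly one edge for every
  other pair of colours. The edges between mixed vertices then form a matching on each side, hence
  \<open>k = 4\<close>, and a 3-colouring of \<open>G\<close> shows how to remove a mixed colour in this last configuration.

  So every class contains a colouring in which \<open>S\<close> and \<open>T\<close> use disjoint sets of colours. There, \<open>S\<close>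
  and \<open>T\<close> can be recoloured independently: all of \<open>S\<close> gets two colours, except for one
  chosen vertex on each odd cycle, all of which share a third colour. Two colourings normalised
  in this way can be matched up to a permutation of the colours, and permutations are Kempe changes.
\<close>

subsection \<open>Kempe changes on unions of components\<close>

lemma colorings_mono:
  assumes "m \<le> n"
  shows "colorings G m \<subseteq> colorings G n"
proof -
  have "{1..m} \<subseteq> {1..n}" using assms by auto
  then show ?thesis
    unfolding colorings_def by (auto simp: PiE_iff subset_eq)
qed

lemma Suc_mod_cancel: "Suc x mod n = Suc y mod n \<longleftrightarrow> x mod n = y mod (n::nat)"
  by (auto simp: mod_Suc split: if_splits)

lemma indicator_sum: "finite P \<Longrightarrow> Q \<subseteq> P \<Longrightarrow> (\<Sum>A\<in>P. if A \<in> Q then 1 else 0 :: nat) = card Q"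
  by (simp add: sum.If_cases Int_absorb1)

lemma component_eq:
  assumes "C \<in> components G" "x \<in> C"
  shows "C = {w. (x, w) \<in> (adj G)\<^sup>*}"
proof -
  obtain v where v: "C = {w. (v, w) \<in> (adj G)\<^sup>*}"
    using assms(1) by (auto simp: components_def)
  have "sym ((adj G)\<^sup>*)"
    by (rule sym_rtrancl) (auto intro: symI adj_sym)
  moreover have "(v, x) \<in> (adj G)\<^sup>*" using assms(2) v by simp
  ultimately have "(x, v) \<in> (adj G)\<^sup>*" by (auto dest: symD)
  with \<open>(v, x) \<in> (adj G)\<^sup>*\<close> show ?thesis
    unfolding v by (auto intro: rtrancl_trans)
qed

locale kempe =
  fixes G :: "'a graph" and k :: nat
  assumes simple: "simple_graph G"
begin

abbreviation keq :: "('a \<Rightarrow> nat) \<Rightarrow> ('a \<Rightarrow> nat) \<Rightarrow> bool" (infix "\<simeq>" 50) where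
  "f \<simeq> g \<equiv> (f, g) \<in> kempe_equivalence G k"

lemma keq_refl: "f \<in> colorings G k \<Longrightarrow> f \<simeq> f"
  by (simp add: kempe_equivalence_def)

lemma keq_sym: "f \<simeq> g \<Longrightarrow> g \<simeq> f"
  using kempe_equivalence_equiv[of G k] by (auto simp: equiv_def dest: symD)

lemma keq_trans [trans]: "f \<simeq> g \<Longrightarrow> g \<simeq> h \<Longrightarrow> f \<simeq> h"
  using kempe_equivalence_equiv[of G k] by (auto simp: equiv_def dest: transD)

lemma keq_col: "f \<simeq> g \<Longrightarrow> g \<in> colorings G k"
  by (simp add: kempe_equivalence_def)

lemma finite_verts: "finite (verts G)"
  using simple by (simp add: simple_graph_def)

lemma edge_verts: "{u, v} \<in> edges G \<Longrightarrow> u \<in> verts G \<and> v \<in> verts G \<and> u \<noteq> v"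
  using simple unfolding simple_graph_def by (fastforce simp: doubleton_eq_iff)

lemma col_range: "f \<in> colorings G k \<Longrightarrow> v \<in> verts G \<Longrightarrow> f v \<in> {1..k}"
  by (auto simp: colorings_def PiE_iff)

lemma col_ext: "f \<in> colorings G k \<Longrightarrow> v \<notin> verts G \<Longrightarrow> f v = undefined"
  by (auto simp: colorings_def PiE_iff extensional_def)

lemma col_proper: "f \<in> colorings G k \<Longrightarrow> {u, v} \<in> edges G \<Longrightarrow> f u \<noteq> f v"
  by (auto simp: colorings_def)

text \<open>Such a \<open>D\<close> is a disjoint union of components of the two-colour subgraph.
  One Kempe change swaps the component of a chosen vertex; the set of vertices coloured
  \<open>i\<close> or \<open>j\<close> stays the same, so the rest of \<open>D\<close> is still
  closed and the induction goes on.\<close>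

lemma swap_closed:
  assumes "f \<in> colorings G k" and ij: "i \<in> {1..k}" "j \<in> {1..k}" "i \<noteq> j"
    and "D \<subseteq> verts G" and "\<And>v. v \<in> D \<Longrightarrow> f v \<in> {i, j}"
    and "\<And>u v. u \<in> D \<Longrightarrow> {u, v} \<in> edges G \<Longrightarrow> f v \<in> {i, j} \<Longrightarrow> v \<in> D"
  shows "f \<simeq> (\<lambda>v. if v \<in> D then transpose i j (f v) else f v)"
  using assms(1,5-7)
proof (induction "card D" arbitrary: D f rule: less_induct)
  case less
  have finD: "finite D" using less.prems(2) finite_verts finite_subset by blast
  show ?case
  proof (cases "D = {}")
    case True
    then show ?thesis using keq_refl less.prems(1) by simp
  next
    case False
    then obtain v where v: "v \<in> D" by auto
    let ?H = "two_color_subgraph G f i j"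
    define C where "C = {w. (v, w) \<in> (adj ?H)\<^sup>*}"
    have vH: "v \<in> verts ?H"
      using v less.prems by (auto simp: two_color_subgraph_def induced_def)
    then have C: "C \<in> components ?H" by (auto simp: components_def C_def)
    have adjH: "{x, y} \<in> edges G \<and> f x \<in> {i, j} \<and> f y \<in> {i, j}" if "(x, y) \<in> adj ?H" for x y
      using that by (auto simp: adj_def two_color_subgraph_def induced_def)
    have CD: "C \<subseteq> D"
    proof
      fix w assume "w \<in> C"
      then have "(v, w) \<in> (adj ?H)\<^sup>*" by (simp add: C_def)
      then show "w \<in> D"
      proof (induction rule: rtrancl_induct)
        case base then show ?case by (rule v)
      next
        case (step y z)
        then show ?case using adjH[of y z] less.prems(4)[of y z] by blast
      qed
    qed
    have vC: "v \<in> C" by (simp add: C_def)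
    let ?f = "\<lambda>v. if v \<in> C then transpose i j (f v) else f v"
    have kc: "kempe_change G k f ?f"
      unfolding kempe_change_def using ij C by blast
    have f1: "?f \<in> colorings G k"
      using kempe_change_colorings[OF simple less.prems(1) kc] .
    have e1: "f \<simeq> ?f"
      using kc f1 less.prems(1) by (auto simp: kempe_equivalence_def)
    have fm: "?f x \<in> {i, j} \<longleftrightarrow> f x \<in> {i, j}" for x
      by (auto simp: transpose_def split: if_splits)
    have "card (D - C) < card D"
      using finD v vC by (intro psubset_card_mono) auto
    moreover have "D - C \<subseteq> verts G" using less.prems by auto
    moreover have "?f x \<in> {i, j}" if "x \<in> D - C" for x
      using less.prems(3)[of x] that by auto
    moreover have "y \<in> D - C" if xy: "x \<in> D - C" "{x, y} \<in> edges G" "?f y \<in> {i, j}" for x y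
    proof -
      have fy: "f y \<in> {i, j}" using xy(3) fm by blast
      have "y \<in> D" using less.prems(4)[of x y] xy fy by blast
      moreover have "y \<notin> C"
      proof
        assume yC: "y \<in> C"
        have "x \<in> verts G" "y \<in> verts G" using edge_verts xy by auto
        then have "(y, x) \<in> adj ?H"
          using xy fy less.prems(3)[of x]
          by (auto simp: adj_def two_color_subgraph_def induced_def insert_commute)
        then have "x \<in> C" using components_closed[OF C yC] by blast
        then show False using xy by simp
      qed
      ultimately show ?thesis by simp
    qed
    ultimately have "?f \<simeq> (\<lambda>v. if v \<in> D - C then transpose i j (?f v) else ?f v)"
      using less.hyps[of "D - C" ?f] f1 by blast
    also have "(\<lambda>v. if v \<in> D - C then transpose i j (?f v) else ?f v)
       = (\<lambda>v. if v \<in> D then transpose i j (f v) else f v)"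
      using CD by (intro ext) auto
    finally show ?thesis using e1 keq_trans by blast
  qed
qed

text \<open>With no neighbour coloured \<open>j\<close>, the vertex is a component by itself, since
  properness already excludes neighbours of its own colour.\<close>

lemma recolor:
  assumes f: "f \<in> colorings G k" and v: "v \<in> verts G" and j: "j \<in> {1..k}"
    and nb: "\<And>u. {v, u} \<in> edges G \<Longrightarrow> f u \<noteq> j"
  shows "f \<simeq> f(v := j)"
proof (cases "f v = j")
  case True
  then have "f(v := j) = f" by auto
  then show ?thesis using keq_refl[OF f] by simp
next
  case False
  have "f \<simeq> (\<lambda>x. if x \<in> {v} then transpose (f v) j (f x) else f x)"
    using False f v j nb col_range[OF f v] col_proper[OF f]
    by (intro swap_closed) (auto, metis)
  also have "(\<lambda>x. if x \<in> {v} then transpose (f v) j (f x) else f x) = f(v := j)"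
    by (auto simp: transpose_def)
  finally show ?thesis .
qed

text \<open>On \<open>X\<close> both maps are proper and use only \<open>a\<close> and
  \<open>b\<close>, so along an edge they agree at both ends or differ at both ends. The set where
  they differ is therefore closed, and swapping it turns \<open>f\<close> into
  \<open>g\<close>.\<close>

lemma match:
  assumes f: "f \<in> colorings G k" and ab: "a \<in> {1..k}" "b \<in> {1..k}" "a \<noteq> b"
    and X: "X \<subseteq> verts G" "\<And>v. v \<in> X \<Longrightarrow> f v \<in> {a, b}" "\<And>v. v \<in> X \<Longrightarrow> g v \<in> {a, b}"
    and cl: "\<And>u v. u \<in> X \<Longrightarrow> {u, v} \<in> edges G \<Longrightarrow> f v \<in> {a, b} \<Longrightarrow> v \<in> X"
    and g: "\<And>u v. u \<in> X \<Longrightarrow> v \<in> X \<Longrightarrow> {u, v} \<in> edges G \<Longrightarrow> g u \<noteq> g v"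
  shows "f \<simeq> (\<lambda>v. if v \<in> X then g v else f v)"
proof -
  let ?D = "{v \<in> X. f v \<noteq> g v}"
  have "f \<simeq> (\<lambda>v. if v \<in> ?D then transpose a b (f v) else f v)"
  proof (rule swap_closed[OF f ab])
    show "?D \<subseteq> verts G" using X by auto
    show "f v \<in> {a, b}" if "v \<in> ?D" for v using X that by auto
    show "v \<in> ?D" if uv: "u \<in> ?D" "{u, v} \<in> edges G" "f v \<in> {a, b}" for u v
    proof -
      have "v \<in> X" using cl uv by blast
      moreover have "f u \<noteq> f v" "g u \<noteq> g v" using col_proper[OF f] g uv \<open>v \<in> X\<close> by auto
      moreover have "f u \<in> {a, b}" "g u \<in> {a, b}" "g v \<in> {a, b}" "f u \<noteq> g u"
        using X uv \<open>v \<in> X\<close> by auto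
      ultimately show ?thesis using uv(3) by auto
    qed
  qed
  also have "(\<lambda>v. if v \<in> ?D then transpose a b (f v) else f v) = (\<lambda>v. if v \<in> X then g v else f v)"
  proof
    fix v
    show "(if v \<in> ?D then transpose a b (f v) else f v) = (if v \<in> X then g v else f v)"
      using X(2,3)[of v] by (auto simp: transpose_def)
  qed
  finally show ?thesis .
qed

text \<open>A permutation of colours is built from transpositions, each of which swaps two colours
  on the whole two-colour subgraph. The measure is the number of vertices where the colourings
  disagree.\<close>

lemma same_partition:
  assumes "f \<in> colorings G k" "g \<in> colorings G k"
    and "\<And>u v. u \<in> verts G \<Longrightarrow> v \<in> verts G \<Longrightarrow> f u = f v \<longleftrightarrow> g u = g v"
  shows "f \<simeq> g"
  using assms(1,3)
proof (induction "card {v \<in> verts G. f v \<noteq> g v}" arbitrary: f rule: less_induct)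
  case less
  show ?case
  proof (cases "\<exists>v\<in>verts G. f v \<noteq> g v")
    case False
    then have "f = g" using col_ext[OF less.prems(1)] col_ext[OF assms(2)] by (metis ext)
    then show ?thesis using keq_refl less.prems by simp
  next
    case True
    then obtain v where v: "v \<in> verts G" "f v \<noteq> g v" by blast
    let ?i = "f v" and ?j = "g v"
    let ?f = "\<lambda>x. if x \<in> {x \<in> verts G. f x \<in> {?i, ?j}} then transpose ?i ?j (f x) else f x"
    have f1: "f \<simeq> ?f"
      using v less.prems(1) col_range[OF less.prems(1) v(1)] col_range[OF assms(2) v(1)] edge_verts
      by (intro swap_closed) auto
    have f1': "?f x = transpose ?i ?j (f x)" if "x \<in> verts G" for x
      using that by (auto simp: transpose_def)
    \<comment> \<open>A vertex that already agrees has colour neither \<open>f v\<close> nor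
      \<open>g v\<close>: as the partitions coincide, either equality would force
      \<open>f v = g v\<close>.\<close>
    have inc: "?f x = g x" if "x \<in> verts G" "f x = g x" for x
    proof -
      have "f x \<noteq> ?i" "f x \<noteq> ?j" using less.prems(2)[of x v] that v by auto
      then show ?thesis using f1'[OF that(1)] that by (simp add: transpose_def)
    qed
    have "?f v = g v" using f1'[OF v(1)] by simp
    then have "{x \<in> verts G. ?f x \<noteq> g x} \<subset> {x \<in> verts G. f x \<noteq> g x}"
      using inc v by blast
    then have "card {x \<in> verts G. ?f x \<noteq> g x} < card {x \<in> verts G. f x \<noteq> g x}"
      using finite_verts by (intro psubset_card_mono) auto
    moreover have "?f x = ?f y \<longleftrightarrow> g x = g y" if "x \<in> verts G" "y \<in> verts G" for x y
      unfolding f1'[OF that(1)] f1'[OF that(2)] using less.prems(2)[OF that]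
      by (metis transpose_involutory)
    ultimately have "?f \<simeq> g" by (intro less.hyps keq_col[OF f1])
    then show ?thesis using f1 keq_trans by blast
  qed
qed

end

subsection \<open>Components of the added edges\<close>

text \<open>Records only the effect of moving \<open>v\<close> into the classes \<open>a\<close>,
  \<open>b\<close>, not the Kempe changes used; colours outside these two classes survive away from
  \<open>v\<close>.\<close>

definition absorbed :: "nat \<Rightarrow> nat \<Rightarrow> 'a \<Rightarrow> ('a \<Rightarrow> nat) \<Rightarrow> ('a \<Rightarrow> nat) \<Rightarrow> bool" where
  "absorbed a b v f f' \<longleftrightarrow> f' v \<in> {a, b} \<and> (\<forall>u. u \<noteq> v \<longrightarrow> f u \<notin> {a, b} \<longrightarrow> f' u = f u) \<and>
     (\<forall>u. f u \<in> {a, b} \<longrightarrow> f' u \<in> {a, b})"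

locale almost_bipartite = kempe G k for G :: "'a graph" and k +
  fixes S T :: "'a set" and E :: "'a set set"
  assumes verts: "verts G = S \<union> T" and disj: "S \<inter> T = {}"
    and E_edges: "E \<subseteq> edges G"
    and E_side: "e \<in> E \<Longrightarrow> e \<subseteq> S \<or> e \<subseteq> T"
    and side_E: "e \<in> edges G \<Longrightarrow> e \<subseteq> S \<or> e \<subseteq> T \<Longrightarrow> e \<in> E"
    and comps: "C \<in> components (edge_graph E) \<Longrightarrow>
           path_graph (induced (edge_graph E) C) \<or>
           (\<exists>n\<ge>4. cycle_graph n (induced (edge_graph E) C)) \<or>
           complete_bipartite (induced (edge_graph E) C)"
begin

text \<open>Everything below is proved for \<open>S\<close>; interpreting the locale with the sides
  exchanged yields the statements for \<open>T\<close>.\<close>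

lemma mirror: "almost_bipartite G T S E"
proof
  show "verts G = T \<union> S" "T \<inter> S = {}" using verts disj by auto
  show "E \<subseteq> edges G" by (rule E_edges)
  show "e \<subseteq> T \<or> e \<subseteq> S" if "e \<in> E" for e using E_side[OF that] by blast
  show "e \<in> E" if "e \<in> edges G" "e \<subseteq> T \<or> e \<subseteq> S" for e using side_E that by blast
qed (rule comps)

lemma E_doubleton: "e \<in> E \<Longrightarrow> \<exists>u v. u \<noteq> v \<and> e = {u, v}"
  using E_edges simple unfolding simple_graph_def by blast

lemma E_edge: "{u, v} \<in> E \<Longrightarrow> {u, v} \<in> edges G"
  using E_edges by blast

lemma E_neq: "{u, v} \<in> E \<Longrightarrow> u \<noteq> v"
  using E_edge edge_verts by blast

lemma E_sym: "{u, v} \<in> E \<Longrightarrow> {v, u} \<in> E"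
  by (simp add: insert_commute)

lemma edge_S: "{u, v} \<in> edges G \<Longrightarrow> u \<in> S \<Longrightarrow> v \<notin> T \<Longrightarrow> {u, v} \<in> E"
  using side_E[of "{u, v}"] edge_verts[of u v] verts by auto

lemma E_S: "{u, v} \<in> E \<Longrightarrow> u \<in> S \<Longrightarrow> v \<in> S"
  using E_side[of "{u, v}"] disj by auto

definition pth :: "'a list \<Rightarrow> bool" where
  "pth p \<longleftrightarrow> distinct p \<and> (\<forall>e\<in>E. e \<inter> set p \<noteq> {} \<longrightarrow> (\<exists>i. Suc i < length p \<and> e = {p ! i, p ! Suc i}))"

text \<open>The cycle is unrolled to an \<open>n\<close>-periodic sequence, so that rotating it is a shift.\<close>

definition cyc :: "(nat \<Rightarrow> 'a) \<Rightarrow> nat \<Rightarrow> bool" where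
  "cyc h n \<longleftrightarrow> 4 \<le> n \<and> (\<forall>x. h (x + n) = h x) \<and> inj_on h {..<n} \<and>
     (\<forall>x. {h x, h (Suc x)} \<in> E) \<and>
     (\<forall>e\<in>E. e \<inter> range h \<noteq> {} \<longrightarrow> (\<exists>x. e = {h x, h (Suc x)}))"

definition cbip :: "'a set \<Rightarrow> 'a set \<Rightarrow> bool" where
  "cbip X Y \<longleftrightarrow> X \<inter> Y = {} \<and> (\<forall>x\<in>X. \<forall>y\<in>Y. {x, y} \<in> E) \<and>
     (\<forall>e\<in>E. e \<inter> (X \<union> Y) \<noteq> {} \<longrightarrow> (\<exists>x\<in>X. \<exists>y\<in>Y. e = {x, y}))"

lemma pth_edge: "pth p \<Longrightarrow> e \<in> E \<Longrightarrow> e \<inter> set p \<noteq> {} \<Longrightarrow> \<exists>i. Suc i < length p \<and> e = {p ! i, p ! Suc i}"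
  by (simp add: pth_def)

lemma cyc_edge: "cyc h n \<Longrightarrow> e \<in> E \<Longrightarrow> e \<inter> range h \<noteq> {} \<Longrightarrow> \<exists>x. e = {h x, h (Suc x)}"
  by (simp add: cyc_def)

lemma cbip_edge: "cbip X Y \<Longrightarrow> e \<in> E \<Longrightarrow> e \<inter> (X \<union> Y) \<noteq> {} \<Longrightarrow> \<exists>x\<in>X. \<exists>y\<in>Y. e = {x, y}"
  by (simp add: cbip_def)

lemma cbip_sym:
  assumes "cbip X Y"
  shows "cbip Y X"
  unfolding cbip_def
proof (intro conjI ballI impI)
  show "Y \<inter> X = {}" using assms by (auto simp: cbip_def)
  show "{y, x} \<in> E" if "y \<in> Y" "x \<in> X" for x y
    using assms that E_sym by (simp add: cbip_def)
  show "\<exists>y\<in>Y. \<exists>x\<in>X. e = {y, x}" if "e \<in> E" "e \<inter> (Y \<union> X) \<noteq> {}" for e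
  proof -
    have "\<exists>x\<in>X. \<exists>y\<in>Y. e = {x, y}" using assms that by (simp add: cbip_def Un_commute)
    then show ?thesis by (auto simp: insert_commute)
  qed
qed

lemma cbip_nbr:
  assumes "cbip X Y" "x \<in> X" "{x, u} \<in> E"
  shows "u \<in> Y"
proof -
  have "{x, u} \<inter> (X \<union> Y) \<noteq> {}" using assms(2) by blast
  then obtain y z where "y \<in> X" "z \<in> Y" "{x, u} = {y, z}"
    using cbip_edge[OF assms(1,3)] by blast
  moreover have "x \<notin> Y" using assms unfolding cbip_def by blast
  ultimately show ?thesis by (auto simp: doubleton_eq_iff)
qed

lemma pth_nbr:
  assumes "pth p" "i < length p" "{p ! i, u} \<in> E"
  shows "(Suc i < length p \<and> u = p ! Suc i) \<or> (i > 0 \<and> u = p ! (i - 1))"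
proof -
  have "{p ! i, u} \<inter> set p \<noteq> {}" using assms(2) by auto
  then obtain j where j: "Suc j < length p" "{p ! i, u} = {p ! j, p ! Suc j}"
    using pth_edge[OF assms(1,3)] by blast
  have eq: "p ! x = p ! y \<longleftrightarrow> x = y" if "x < length p" "y < length p" for x y
    using assms(1) that by (simp add: pth_def nth_eq_iff_index_eq)
  show ?thesis using j assms(2) eq by (auto simp: doubleton_eq_iff)
qed

lemma cyc_mod: "cyc h n \<Longrightarrow> h (x mod n) = h x"
proof (induction x rule: less_induct)
  case (less x)
  show ?case
  proof (cases "x < n")
    case False
    moreover have "n > 0" using less.prems by (simp add: cyc_def)
    ultimately have "h ((x - n) mod n) = h (x - n)" using less by simp
    moreover have "(x - n) mod n = x mod n" using False by (simp add: le_mod_geq)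
    moreover have "h (x - n + n) = h (x - n)" using less.prems by (simp only: cyc_def)
    ultimately show ?thesis using False by simp
  qed simp
qed

lemma cyc_eq:
  assumes "cyc h n"
  shows "h x = h y \<longleftrightarrow> x mod n = y mod n"
proof -
  have "inj_on h {..<n}" "n > 0" using assms by (auto simp: cyc_def)
  then have "h (x mod n) = h (y mod n) \<longleftrightarrow> x mod n = y mod n"
    by (auto simp: inj_on_def)
  then show ?thesis using cyc_mod[OF assms] by simp
qed

lemma cyc_nbr:
  assumes "cyc h n" "{h (Suc x), u} \<in> E"
  shows "u = h (Suc (Suc x)) \<or> u = h x"
proof -
  have "{h (Suc x), u} \<inter> range h \<noteq> {}" by auto
  then obtain y where y: "{h (Suc x), u} = {h y, h (Suc y)}"
    using cyc_edge[OF assms] by blast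
  then consider "h (Suc x) = h y" "u = h (Suc y)" | "h (Suc x) = h (Suc y)" "u = h y"
    by (auto simp: doubleton_eq_iff)
  then show ?thesis
    by cases (auto simp: cyc_eq[OF assms(1)] Suc_mod_cancel)
qed

lemma cyc_shift:
  assumes "cyc h n"
  shows "cyc (\<lambda>x. h (x + s)) n" "range (\<lambda>x. h (x + s)) = range h"
proof -
  have n: "n > 0" using assms by (auto simp: cyc_def)
  \<comment> \<open>Every residue class has a representative of size at least \<open>s\<close>, so
    that the later natural subtraction \<open>x - s\<close> is exact.\<close>
  have surj: "\<exists>x. x mod n = y mod n \<and> s \<le> x" for y
  proof -
    have "(y + s * n) mod n = y mod n" "s \<le> y + s * n" using n by (auto simp: trans_le_add2)
    then show ?thesis by blast
  qed
  have ex: "\<exists>z. h y = h (z + s)" for y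
  proof -
    obtain x where "x mod n = y mod n" "s \<le> x" using surj by blast
    then have "h y = h (x - s + s)" using cyc_eq[OF assms] by simp
    then show ?thesis by blast
  qed
  then show r: "range (\<lambda>x. h (x + s)) = range h" by auto
  have sh: "(x + s) mod n = (y + s) mod n \<longleftrightarrow> x mod n = y mod n" for x y
    by (induction s) (auto simp: Suc_mod_cancel)
  have "inj_on (\<lambda>x. h (x + s)) {..<n}"
    by (auto simp: inj_on_def cyc_eq[OF assms] sh)
  moreover have "h (x + n + s) = h (x + s)" for x
  proof -
    have "x + n + s = x + s + n" by simp
    then show ?thesis by (simp only: cyc_eq[OF assms] mod_add_self2)
  qed
  moreover have "\<exists>x. e = {h (x + s), h (Suc x + s)}"
    if e: "e \<in> E" "e \<inter> range h \<noteq> {}" for e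
  proof -
    obtain y where y: "e = {h y, h (Suc y)}" using cyc_edge[OF assms e] by blast
    obtain x where x: "x mod n = y mod n" "s \<le> x" using surj by blast
    then have "h x = h y" "h (Suc x) = h (Suc y)" by (simp_all add: cyc_eq[OF assms] Suc_mod_cancel)
    then have "e = {h (x - s + s), h (Suc (x - s) + s)}" using y x by simp
    then show ?thesis by blast
  qed
  ultimately show "cyc (\<lambda>x. h (x + s)) n"
    using assms unfolding cyc_def r by simp
qed

text \<open>Supplies coordinates adapted to \<open>v\<close>: the cycle is rotated to start at
  \<open>v\<close>, and the parts of the complete bipartite graph are ordered so that
  \<open>v\<close> lies in the first. For cycles the component itself is kept as well, since one
  root per odd cycle is chosen later.\<close>

lemma component_shape:
  assumes "v \<in> \<Union>E"
  obtains p i where "pth p" "i < length p" "p ! i = v"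
  | h n where "cyc h n" "h 0 = v" "range h \<in> components (edge_graph E)"
  | X Y where "cbip X Y" "v \<in> X"
proof -
  let ?H = "edge_graph E"
  define C where "C = {w. (v, w) \<in> (adj ?H)\<^sup>*}"
  have C: "C \<in> components ?H"
    using assms by (auto simp: components_def C_def edge_graph_def)
  have vC: "v \<in> C" by (simp add: C_def)
  have cl: "e \<subseteq> C" if "e \<in> E" "e \<inter> C \<noteq> {}" for e
  proof -
    obtain x y where e: "e = {x, y}" using E_doubleton[OF \<open>e \<in> E\<close>] by blast
    have "(x, y) \<in> adj ?H" "(y, x) \<in> adj ?H"
      using that(1) e by (auto simp: adj_def edge_graph_def insert_commute)
    then show ?thesis using components_closed[OF C] that(2) e by auto
  qed
  have VC: "verts (induced ?H C) = C"
    using components_subset[OF C] by (auto simp: induced_def edge_graph_def)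
  have EC: "edges (induced ?H C) = {e \<in> E. e \<inter> C \<noteq> {}}"
  proof -
    have "e \<inter> C \<noteq> {}" if "e \<in> E" "e \<subseteq> C" for e
      using E_doubleton[OF that(1)] that(2) by auto
    then show ?thesis using cl by (auto simp: induced_def edge_graph_def)
  qed
  from comps[OF C] consider "path_graph (induced ?H C)" |
      n where "n \<ge> 4" "cycle_graph n (induced ?H C)" | "complete_bipartite (induced ?H C)" by blast
  then show ?thesis
  proof cases
    case 1
    then obtain p where p: "distinct p" "C = set p"
      and pE: "{e \<in> E. e \<inter> C \<noteq> {}} = {{p ! i, p ! Suc i} | i. Suc i < length p}"
      unfolding path_graph_def VC EC by blast
    have "\<exists>i. Suc i < length p \<and> e = {p ! i, p ! Suc i}" if "e \<in> E" "e \<inter> set p \<noteq> {}" for e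
    proof -
      have "e \<in> {e \<in> E. e \<inter> C \<noteq> {}}" using that p(2) by simp
      then show ?thesis unfolding pE by blast
    qed
    then have "pth p" using p(1) unfolding pth_def by blast
    then show ?thesis using that(1) vC p(2) by (metis in_set_conv_nth)
  next
    case 2
    then obtain p where p: "length p = n" "distinct p" "C = set p"
      and pE: "{e \<in> E. e \<inter> C \<noteq> {}} = {{p ! i, p ! (Suc i mod n)} | i. i < n}"
      unfolding cycle_graph_def VC EC by blast
    have mem: "e \<in> E \<and> e \<inter> C \<noteq> {} \<longleftrightarrow> (\<exists>i. e = {p ! i, p ! (Suc i mod n)} \<and> i < n)" for e
    proof -
      have "e \<in> {e \<in> E. e \<inter> C \<noteq> {}} \<longleftrightarrow> e \<in> {{p ! i, p ! (Suc i mod n)} | i. i < n}"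
        unfolding pE by (rule refl)
      then show ?thesis unfolding mem_Collect_eq .
    qed
    let ?h = "\<lambda>x. p ! (x mod n)"
    have n: "n > 0" using 2 by simp
    have r: "range ?h = C"
    proof -
      have "p ! i \<in> range ?h" if "i < n" for i using that by (metis mod_less rangeI)
      moreover have "?h x \<in> set p" for x using n p(1) by simp
      ultimately show ?thesis using p(1,3) by (auto simp: in_set_conv_nth)
    qed
    have "{?h x, ?h (Suc x)} \<in> E" for x
    proof -
      have "x mod n < n" "Suc x mod n = Suc (x mod n) mod n" using n by (simp_all add: mod_Suc_eq)
      then show ?thesis using mem[of "{?h x, ?h (Suc x)}"] by auto
    qed
    moreover have "\<exists>x. e = {?h x, ?h (Suc x)}" if e: "e \<in> E" "e \<inter> C \<noteq> {}" for e
    proof -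
      obtain i where "i < n" "e = {p ! i, p ! (Suc i mod n)}" using e mem[of e] by blast
      then show ?thesis by (intro exI[of _ i]) simp
    qed
    moreover have "inj_on ?h {..<n}"
      using p(1,2) by (auto simp: inj_on_def nth_eq_iff_index_eq)
    ultimately have c: "cyc ?h n" using 2(1) unfolding cyc_def r by simp
    obtain s where s: "v = ?h s" using vC r by blast
    show ?thesis
      using that(2)[OF cyc_shift(1)[OF c, of s]] s C cyc_shift(2)[OF c, of s] r by simp
  next
    case 3
    then obtain X Y where XY: "X \<inter> Y = {}" "C = X \<union> Y"
      "{e \<in> E. e \<inter> C \<noteq> {}} = {{x, y} | x y. x \<in> X \<and> y \<in> Y}"
      unfolding complete_bipartite_def VC EC by blast
    have mem: "e \<in> E \<and> e \<inter> C \<noteq> {} \<longleftrightarrow> (\<exists>x y. e = {x, y} \<and> x \<in> X \<and> y \<in> Y)" for e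
    proof -
      have "e \<in> {e \<in> E. e \<inter> C \<noteq> {}} \<longleftrightarrow> e \<in> {{x, y} | x y. x \<in> X \<and> y \<in> Y}"
        unfolding XY(3) by (rule refl)
      then show ?thesis unfolding mem_Collect_eq .
    qed
    have cb: "cbip X Y"
      unfolding cbip_def
    proof (intro conjI ballI impI)
      show "X \<inter> Y = {}" by (rule XY(1))
      show "{x, y} \<in> E" if "x \<in> X" "y \<in> Y" for x y
        using mem[of "{x, y}"] that by blast
      show "\<exists>x\<in>X. \<exists>y\<in>Y. e = {x, y}" if "e \<in> E" "e \<inter> (X \<union> Y) \<noteq> {}" for e
        using mem[of e] that XY(2) by auto
    qed
    have "v \<in> X \<or> v \<in> Y" using vC XY(2) by simp
    then show ?thesis using that(3)[OF cb] that(3)[OF cbip_sym[OF cb]] by auto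
  qed
qed

text \<open>Colours \<open>a\<close> and \<open>b\<close> do not occur on \<open>T\<close>, so only
  edges of \<open>E\<close> matter. If \<open>c1 = c2\<close>, the other of the two colours is free
  at \<open>v\<close>. Otherwise swapping on \<open>D\<close> turns the neighbours of colour
  \<open>c1\<close> into colour \<open>c2\<close>, after which \<open>c1\<close> is free at
  \<open>v\<close>.\<close>

lemma absorb_by_swap:
  assumes f: "f \<in> colorings G k" and ab: "a \<in> {1..k}" "b \<in> {1..k}" "a \<noteq> b"
    and pure: "\<And>x. x \<in> T \<Longrightarrow> f x \<notin> {a, b}" and v: "v \<in> S" "f v \<notin> {a, b}"
    and D: "D \<subseteq> S" "\<And>x. x \<in> D \<Longrightarrow> f x \<in> {a, b}"
    and cl: "\<And>x y. x \<in> D \<Longrightarrow> {x, y} \<in> E \<Longrightarrow> f y \<in> {a, b} \<Longrightarrow> y \<in> D"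
    and c: "c1 \<in> {a, b}" "c2 \<in> {a, b}"
    and c1: "\<And>x. x \<in> D \<Longrightarrow> {v, x} \<in> E \<Longrightarrow> f x = c1"
    and c2: "\<And>x. x \<notin> D \<Longrightarrow> {v, x} \<in> E \<Longrightarrow> f x \<in> {a, b} \<Longrightarrow> f x = c2"
  shows "\<exists>f'. f \<simeq> f' \<and> absorbed a b v f f'"
proof (cases "c1 = c2")
  case True
  obtain c' where c': "c' \<in> {a, b}" "c' \<noteq> c1" using ab(3) by (metis insertCI)
  have "f \<simeq> f(v := c')"
  proof (rule recolor[OF f])
    show "v \<in> verts G" "c' \<in> {1..k}" using v(1) verts c'(1) ab(1,2) by auto
    show "f u \<noteq> c'" if e: "{v, u} \<in> edges G" for u
    proof
      assume u: "f u = c'"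
      then have "u \<notin> T" using pure[of u] c'(1) by blast
      then have "{v, u} \<in> E" using edge_S[OF e v(1)] by blast
      then show False using c1[of u] c2[of u] u c' True by (cases "u \<in> D") auto
    qed
  qed
  then show ?thesis using c' by (intro exI[of _ "f(v := c')"]) (auto simp: absorbed_def)
next
  case False
  let ?f = "\<lambda>x. if x \<in> D then transpose a b (f x) else f x"
  have f1: "f \<simeq> ?f"
  proof (rule swap_closed[OF f ab])
    show "y \<in> D" if "x \<in> D" "{x, y} \<in> edges G" "f y \<in> {a, b}" for x y
    proof -
      have "{x, y} \<in> E" using edge_S[OF that(2)] pure[of y] that D(1) by blast
      then show ?thesis using cl that by blast
    qed
    show "D \<subseteq> verts G" using D(1) verts by auto
  qed (rule D(2))
  have vD: "v \<notin> D" using D(2) v(2) by blast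
  have "?f \<simeq> ?f(v := c1)"
  proof (rule recolor[OF keq_col[OF f1]])
    show "v \<in> verts G" "c1 \<in> {1..k}" using v(1) verts c(1) ab(1,2) by auto
    show "?f u \<noteq> c1" if e: "{v, u} \<in> edges G" for u
    proof (cases "u \<in> T")
      case True
      then have "u \<notin> D" using D(1) disj by blast
      then show ?thesis using pure[OF True] c(1) by auto
    next
      case F: False
      then have e': "{v, u} \<in> E" using edge_S[OF e v(1)] by blast
      show ?thesis
      proof (cases "u \<in> D")
        case True
        then have "f u = c1" using c1 e' by blast
        then show ?thesis using True c False ab(3) by (auto simp: transpose_def)
      next
        case nD: False
        then show ?thesis using c2[OF nD e'] c(1) False by auto
      qed
    qed
  qed
  then have "f \<simeq> ?f(v := c1)" using keq_trans[OF f1] by blast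
  moreover have "absorbed a b v f (?f(v := c1))"
    unfolding absorbed_def
  proof (intro conjI allI impI)
    show "(?f(v := c1)) v \<in> {a, b}" using c(1) by simp
    show "(?f(v := c1)) u = f u" if "u \<noteq> v" "f u \<notin> {a, b}" for u
      using that D(2)[of u] by auto
    show "(?f(v := c1)) u \<in> {a, b}" if "f u \<in> {a, b}" for u
      using that c(1) by (auto simp: transpose_def)
  qed
  ultimately show ?thesis by blast
qed

lemma cyc_nbr0:
  assumes "cyc h n" "{h 0, u} \<in> E"
  shows "u = h 1 \<or> u = h (n - 1)"
proof -
  have n: "n > 0" and per: "h (x + n) = h x" for x using assms(1) by (simp_all add: cyc_def)
  have "h (Suc (n - 1)) = h 0" using per[of 0] n by simp
  moreover have "h (Suc (Suc (n - 1))) = h 1" using per[of 1] n by simp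
  ultimately show ?thesis using cyc_nbr[OF assms(1), of "n - 1" u] assms(2) by simp
qed

text \<open>If \<open>v\<close> sees both \<open>a\<close> and \<open>b\<close>, swap these colours on one side of \<open>v\<close>: on a path this is
  separated from the other side by \<open>v\<close> itself, on a cycle by \<open>v\<close> and a second vertex coloured neither
  \<open>a\<close> nor \<open>b\<close>, and in a complete bipartite graph the part opposite to \<open>v\<close> can be made monochromatic.\<close>

lemma absorb:
  assumes f: "f \<in> colorings G k" and ab: "a \<in> {1..k}" "b \<in> {1..k}" "a \<noteq> b"
    and pure: "\<And>x. x \<in> T \<Longrightarrow> f x \<notin> {a, b}" and v: "v \<in> S" "f v \<notin> {a, b}"
  obtains (reduced) f' where "f \<simeq> f'" "absorbed a b v f f'"
  | (odd_cycle) h n where "cyc h n" "odd n" "h 0 = v" "range h \<in> components (edge_graph E)"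
      "\<And>x. 0 < x \<Longrightarrow> x < n \<Longrightarrow> f (h x) \<in> {a, b}"
proof -
  have swap: "\<exists>f'. f \<simeq> f' \<and> absorbed a b v f f'"
    if "D \<subseteq> S" "\<And>x. x \<in> D \<Longrightarrow> f x \<in> {a, b}"
      "\<And>x y. x \<in> D \<Longrightarrow> {x, y} \<in> E \<Longrightarrow> f y \<in> {a, b} \<Longrightarrow> y \<in> D"
      "c1 \<in> {a, b}" "c2 \<in> {a, b}" "\<And>x. x \<in> D \<Longrightarrow> {v, x} \<in> E \<Longrightarrow> f x = c1"
      "\<And>x. x \<notin> D \<Longrightarrow> {v, x} \<in> E \<Longrightarrow> f x \<in> {a, b} \<Longrightarrow> f x = c2" for D c1 c2
    by (rule absorb_by_swap[OF f ab pure v that])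
  have "(\<exists>f'. f \<simeq> f' \<and> absorbed a b v f f') \<or> (\<exists>h n. cyc h n \<and> odd n \<and> h 0 = v \<and>
     range h \<in> components (edge_graph E) \<and> (\<forall>x. 0 < x \<longrightarrow> x < n \<longrightarrow> f (h x) \<in> {a, b}))"
  proof (cases "v \<in> \<Union>E")
    case False
    then have "{v, x} \<notin> E" for x by blast
    then have "\<exists>f'. f \<simeq> f' \<and> absorbed a b v f f'"
      by (intro swap[of "{}" a a]) auto
    then show ?thesis by blast
  next
    case True
    then show ?thesis
    proof (cases rule: component_shape)
      case (1 p i)
      \<comment> \<open>The part of the path before \<open>v\<close>. Membership in \<open>S\<close>
        is demanded explicitly because \<open>pth\<close> does not assert that consecutive entries
        are adjacent.\<close>
      define D where "D = {p ! j | j. j < i \<and> f (p ! j) \<in> {a, b} \<and> p ! j \<in> S}"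
      have inj: "p ! x = p ! y \<longleftrightarrow> x = y" if "x < length p" "y < length p" for x y
        using 1(1) that by (simp add: pth_def nth_eq_iff_index_eq)
      have nb: "(Suc i < length p \<and> u = p ! Suc i) \<or> (i > 0 \<and> u = p ! (i - 1))" if "{v, u} \<in> E" for u
        using pth_nbr[OF 1(1,2)] that 1(3) by simp
      have cl: "y \<in> D" if xD: "x \<in> D" and that: "{x, y} \<in> E" "f y \<in> {a, b}" for x y
      proof -
        obtain j where j: "j < i" "x = p ! j" "x \<in> S" using xD by (auto simp: D_def)
        have yS: "y \<in> S" using E_S that(1) j(3) by blast
        have "(Suc j < length p \<and> y = p ! Suc j) \<or> (j > 0 \<and> y = p ! (j - 1))"
          using pth_nbr[OF 1(1), of j y] 1(2) that j by simp
        then show ?thesis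
        proof
          assume y: "Suc j < length p \<and> y = p ! Suc j"
          have "Suc j \<noteq> i" using y 1(3) v(2) that(2) by auto
          then have "Suc j < i" using j by simp
          then show ?thesis unfolding D_def using y yS that(2) by blast
        next
          assume y: "j > 0 \<and> y = p ! (j - 1)"
          then have "j - 1 < i" using j by simp
          then show ?thesis unfolding D_def using y yS that(2) by blast
        qed
      qed
      \<comment> \<open>The colour that \<open>v\<close> sees before it on the path; the default
        \<open>a\<close> only secures a value in \<open>{a, b}\<close> when there is no such
        neighbour. Likewise \<open>c2\<close> for the other direction.\<close>
      define c1 where "c1 = (if f (p ! (i - 1)) \<in> {a, b} then f (p ! (i - 1)) else a)"
      define c2 where "c2 = (if f (p ! Suc i) \<in> {a, b} then f (p ! Suc i) else a)"
      have "\<exists>f'. f \<simeq> f' \<and> absorbed a b v f f'"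
      proof (rule swap[of D c1 c2])
        show "f x = c1" if "x \<in> D" "{v, x} \<in> E" for x
        proof -
          obtain j where j: "j < i" "x = p ! j" "f x \<in> {a, b}" using \<open>x \<in> D\<close> by (auto simp: D_def)
          have "x \<noteq> p ! Suc i" if "Suc i < length p" using inj[of j "Suc i"] j that by auto
          then show ?thesis using nb[OF that(2)] j(3) by (auto simp: c1_def)
        qed
        show "f x = c2" if "x \<notin> D" "{v, x} \<in> E" "f x \<in> {a, b}" for x
        proof -
          have "x \<in> S" using E_S that v by blast
          then have "\<not> (i > 0 \<and> x = p ! (i - 1))" using that by (auto simp: D_def)
          then show ?thesis using nb[OF that(2)] that(3) by (auto simp: c2_def)
        qed
        show "D \<subseteq> S" "\<And>x. x \<in> D \<Longrightarrow> f x \<in> {a, b}" by (auto simp: D_def)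
        show "c1 \<in> {a, b}" "c2 \<in> {a, b}" by (simp_all add: c1_def c2_def)
      qed (rule cl)
      then show ?thesis by blast
    next
      case (2 h n)
      have n: "n \<ge> 4" using 2(1) by (simp add: cyc_def)
      have nb: "u = h 1 \<or> u = h (n - 1)" if "{v, u} \<in> E" for u
        using cyc_nbr0[OF 2(1)] that 2(2) by simp
      have inj: "h x = h y \<longleftrightarrow> x = y" if "x < n" "y < n" for x y
        using cyc_eq[OF 2(1)] that by simp
      show ?thesis
      proof (cases "\<forall>x. 0 < x \<longrightarrow> x < n \<longrightarrow> f (h x) \<in> {a, b}")
        case all: True
        show ?thesis
        proof (cases "odd n")
          case True
          then show ?thesis using 2 all by blast
        next
          case False
          have alt: "f (h (Suc x)) = (if even x then f (h 1) else (if f (h 1) = a then b else a))"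
            if "Suc x < n" for x
            using that
          proof (induction x)
            case (Suc x)
            have "{h (Suc x), h (Suc (Suc x))} \<in> E" using 2(1) by (simp add: cyc_def)
            then have "f (h (Suc x)) \<noteq> f (h (Suc (Suc x)))" using col_proper[OF f] E_edge by blast
            moreover have "f (h (Suc x)) \<in> {a, b}" "f (h (Suc (Suc x))) \<in> {a, b}" "f (h 1) \<in> {a, b}"
              using all[rule_format, of "Suc x"] all[rule_format, of "Suc (Suc x)"]
                all[rule_format, of 1] Suc.prems n by auto
            ultimately show ?case using Suc ab(3) by auto
          qed simp
          have "f (h (n - 1)) = f (h 1)"
            using alt[of "n - 2"] n False by (simp add: numeral_2_eq_2 Suc_diff_Suc)
          then have "f x = f (h 1)" if "{v, x} \<in> E" for x using nb[OF that] by auto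
          moreover have "f (h 1) \<in> {a, b}" using all n by simp
          ultimately have "\<exists>f'. f \<simeq> f' \<and> absorbed a b v f f'"
            by (intro swap[of "{}" "f (h 1)" "f (h 1)"]) auto
          then show ?thesis by blast
        qed
      next
        case False
        then obtain m where m: "0 < m" "m < n" "f (h m) \<notin> {a, b}" by blast
        define D where "D = {h j | j. 0 < j \<and> j < m \<and> f (h j) \<in> {a, b} \<and> h j \<in> S}"
        have cl: "y \<in> D" if "x \<in> D" "{x, y} \<in> E" "f y \<in> {a, b}" for x y
        proof -
          obtain j where j: "Suc j < m" "x = h (Suc j)" "x \<in> S"
            using \<open>x \<in> D\<close> unfolding D_def by (auto simp: gr0_conv_Suc)
          have yS: "y \<in> S" using E_S that(2) j(3) by blast
          have "y = h (Suc (Suc j)) \<or> y = h j" using cyc_nbr[OF 2(1)] that(2) j(2) by blast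
          then show ?thesis
          proof
            assume y: "y = h (Suc (Suc j))"
            have "Suc (Suc j) \<noteq> m" using y m that(3) by auto
            then have "Suc (Suc j) < m" using j by simp
            then show ?thesis unfolding D_def using y yS that(3) by blast
          next
            assume y: "y = h j"
            have "j \<noteq> 0"
            proof
              assume "j = 0"
              then show False using y that(3) v(2) 2(2) by simp
            qed
            then have "0 < j" "j < m" using j(1) by auto
            then show ?thesis unfolding D_def using y yS that(3) by blast
          qed
        qed
        define c1 where "c1 = (if f (h 1) \<in> {a, b} then f (h 1) else a)"
        define c2 where "c2 = (if f (h (n - 1)) \<in> {a, b} then f (h (n - 1)) else a)"
        have "\<exists>f'. f \<simeq> f' \<and> absorbed a b v f f'"
        proof (rule swap[of D c1 c2])
          show "f x = c1" if "x \<in> D" "{v, x} \<in> E" for x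
          proof -
            obtain j where j: "j < m" "x = h j" "f x \<in> {a, b}" using \<open>x \<in> D\<close> by (auto simp: D_def)
            have "x \<noteq> h (n - 1)" using inj[of j "n - 1"] j m by auto
            then show ?thesis using nb[OF that(2)] j(3) by (auto simp: c1_def)
          qed
          show "f x = c2" if "x \<notin> D" "{v, x} \<in> E" "f x \<in> {a, b}" for x
          proof -
            have xS: "x \<in> S" using E_S that v by blast
            have "x \<noteq> h 1"
            proof
              assume x: "x = h 1"
              then have "m \<noteq> 1" using m that(3) by auto
              then have "1 < m" using m by simp
              then show False using that x xS unfolding D_def by blast
            qed
            then show ?thesis using nb[OF that(2)] that(3) by (auto simp: c2_def)
          qed
          show "D \<subseteq> S" "\<And>x. x \<in> D \<Longrightarrow> f x \<in> {a, b}" by (auto simp: D_def)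
        show "c1 \<in> {a, b}" "c2 \<in> {a, b}" by (simp_all add: c1_def c2_def)
      qed (rule cl)
        then show ?thesis by blast
      qed
    next
      case (3 X Y)
      have nb: "u \<in> Y" if "{v, u} \<in> E" for u
        using cbip_nbr[OF 3(1)] 3(2) that by blast
      have opp: "y \<in> X" if "x \<in> Y" "{x, y} \<in> E" for x y
        using cbip_nbr[OF cbip_sym[OF 3(1)]] that by blast
      show ?thesis
      proof (cases "\<exists>y\<in>Y. \<exists>z\<in>Y. f y = a \<and> f z = b")
        case True
        then obtain y z where yz: "y \<in> Y" "z \<in> Y" "f y = a" "f z = b" by blast
        \<comment> \<open>Both colours occur in \<open>Y\<close> and every vertex of
          \<open>X\<close> is adjacent to all of \<open>Y\<close>. Hence the vertices of colour
          \<open>a\<close> in \<open>Y\<close> have no \<open>E\<close>-neighbour coloured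
          \<open>a\<close> or \<open>b\<close> and can be swapped on their own.\<close>
        have X: "f x \<notin> {a, b}" if "x \<in> X" for x
        proof -
          have "{x, y} \<in> E" "{x, z} \<in> E" using 3(1) that yz(1,2) by (simp_all add: cbip_def)
          then have "f x \<noteq> f y" "f x \<noteq> f z" using col_proper[OF f] E_edge by blast+
          then show ?thesis using yz(3,4) by simp
        qed
        have "\<exists>f'. f \<simeq> f' \<and> absorbed a b v f f'"
        proof (rule swap[of "{y \<in> Y \<inter> S. f y = a}" a b])
          show "y \<in> {y \<in> Y \<inter> S. f y = a}"
            if "x \<in> {y \<in> Y \<inter> S. f y = a}" "{x, y} \<in> E" "f y \<in> {a, b}" for x y
            using opp[of x y] X[of y] that by blast
          show "f x = b" if "x \<notin> {y \<in> Y \<inter> S. f y = a}" "{v, x} \<in> E" "f x \<in> {a, b}" for x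
            using nb[OF that(2)] E_S[OF that(2) v(1)] that by blast
        qed auto
        then show ?thesis by blast
      next
        case False
        then obtain c where "c \<in> {a, b}" "\<And>y. y \<in> Y \<Longrightarrow> f y \<in> {a, b} \<Longrightarrow> f y = c" by blast
        then have "\<exists>f'. f \<simeq> f' \<and> absorbed a b v f f'"
          using nb by (intro swap[of "{}" c c]) auto
        then show ?thesis by blast
      qed
    qed
  qed
  then show ?thesis
  proof (elim disjE exE conjE)
    show thesis if "f \<simeq> f'" "absorbed a b v f f'" for f'
      using that by (rule reduced)
    show thesis if "cyc h n" "odd n" "h 0 = v" "range h \<in> components (edge_graph E)"
      "\<forall>x. 0 < x \<longrightarrow> x < n \<longrightarrow> f (h x) \<in> {a, b}" for h n
      using that(1-4) that(5)[rule_format] by (rule odd_cycle)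
  qed
qed

subsection \<open>Colours used on both sides\<close>

definition mixed :: "('a \<Rightarrow> nat) \<Rightarrow> nat set" where
  "mixed f = f ` S \<inter> f ` T"

lemma finite_parts: "finite S" "finite T"
  using finite_verts verts by auto

lemma finite_mixed: "finite (mixed f)"
  using finite_parts by (simp add: mixed_def)

lemma mixed_range: "f \<in> colorings G k \<Longrightarrow> mixed f \<subseteq> {1..k}"
  using col_range verts by (auto simp: mixed_def)

lemma E_verts: "{u, v} \<in> E \<Longrightarrow> u \<in> S \<union> T \<and> v \<in> S \<union> T"
  using E_edge edge_verts verts by blast

lemma finite_E: "finite E"
proof -
  have "e \<subseteq> S \<union> T" if "e \<in> E" for e using E_side[OF that] by blast
  then have "E \<subseteq> Pow (S \<union> T)" by blast
  then show ?thesis using finite_parts finite_subset by blast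
qed

text \<open>Colouring the vertices of these two classes by their side, \<open>i\<close> on
  \<open>S\<close> and \<open>j\<close> on \<open>T\<close>, is proper there, so
  \<open>match\<close> reaches it.\<close>

lemma flip:
  assumes f: "f \<in> colorings G k" and ij: "i \<in> {1..k}" "j \<in> {1..k}" "i \<noteq> j"
    and none: "\<And>u v. {u, v} \<in> E \<Longrightarrow> f u = i \<Longrightarrow> f v = j \<Longrightarrow> False"
  obtains f' where "f \<simeq> f'" "mixed f' \<subseteq> mixed f - {i, j}" "j \<notin> f' ` S"
    "\<And>u. f u \<notin> {i, j} \<Longrightarrow> f' u = f u"
proof -
  define X where "X = {v \<in> verts G. f v \<in> {i, j}}"
  let ?f = "\<lambda>v. if v \<in> X then if v \<in> S then i else j else f v"
  have "f \<simeq> ?f"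
  proof (rule match[OF f ij])
    show "(if u \<in> S then i else j) \<noteq> (if v \<in> S then i else j)"
      if uv: "u \<in> X" "v \<in> X" "{u, v} \<in> edges G" for u v
    proof -
      have "f u \<noteq> f v" using col_proper[OF f uv(3)] .
      then have "{u, v} \<notin> E"
        using none[of u v] none[of v u] uv(1,2) E_sym[of u v] by (auto simp: X_def)
      then have "\<not> (u \<in> S \<and> v \<in> S)" "\<not> (u \<in> T \<and> v \<in> T)" using side_E[OF uv(3)] by auto
      moreover have "u \<in> S \<union> T" "v \<in> S \<union> T" using uv verts by (auto simp: X_def)
      ultimately show ?thesis using ij(3) disj by auto
    qed
    show "v \<in> X" if "{u, v} \<in> edges G" "f v \<in> {i, j}" for u v
      using edge_verts[OF that(1)] that(2) by (simp add: X_def)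
  qed (auto simp: X_def)
  moreover have "mixed ?f \<subseteq> mixed f - {i, j}"
  proof
    fix c assume "c \<in> mixed ?f"
    then obtain s t where st: "s \<in> S" "t \<in> T" "c = ?f s" "c = ?f t" by (auto simp: mixed_def)
    have "t \<notin> S" "s \<in> verts G" "t \<in> verts G" using st disj verts by auto
    then show "c \<in> mixed f - {i, j}"
      using st ij(3) by (auto simp: mixed_def X_def intro: rev_image_eqI split: if_splits)
  qed
  moreover have "j \<notin> ?f ` S" using ij(3) verts by (auto simp: X_def)
  moreover have "?f u = f u" if "f u \<notin> {i, j}" for u using that by (auto simp: X_def)
  ultimately show ?thesis by (rule that)
qed

definition least_mixed :: "('a \<Rightarrow> nat) \<Rightarrow> bool" where
  "least_mixed f \<longleftrightarrow> f \<in> colorings G k \<and> mixed f \<noteq> {} \<and>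
     (\<forall>f'. f \<simeq> f' \<longrightarrow> card (mixed f) \<le> card (mixed f'))"

lemma least_mixed_step:
  assumes "least_mixed f" "f \<simeq> f'" "mixed f' \<subseteq> mixed f"
  shows "mixed f' = mixed f" "least_mixed f'"
proof -
  have "card (mixed f) \<le> card (mixed f')" using assms by (simp add: least_mixed_def)
  then show eq: "mixed f' = mixed f" using card_seteq[OF finite_mixed assms(3)] by simp
  show "least_mixed f'"
    using assms keq_trans[OF assms(2)] keq_col[OF assms(2)] by (simp add: least_mixed_def eq)
qed

text \<open>Otherwise \<open>flip\<close> would make both colours pure and lower the number of mixed
  colours.\<close>

lemma least_mixed_edge:
  assumes f: "least_mixed f" and ij: "i \<in> {1..k}" "j \<in> {1..k}" "i \<noteq> j"
    and m: "i \<in> mixed f \<or> j \<in> mixed f"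
  shows "\<exists>u v. {u, v} \<in> E \<and> f u = i \<and> f v = j"
proof (rule ccontr)
  assume none: "\<not> ?thesis"
  have col: "f \<in> colorings G k" using f by (simp add: least_mixed_def)
  obtain f' where "f \<simeq> f'" "mixed f' \<subseteq> mixed f - {i, j}"
    by (rule flip[OF col ij]) (use none in blast)+
  then show False using least_mixed_step(1)[OF f] m by blast
qed

lemma least_mixed_used:
  assumes f: "least_mixed f" and i: "i \<in> {1..k}"
  shows "i \<in> f ` S \<union> f ` T"
proof (rule ccontr)
  assume unused: "i \<notin> f ` S \<union> f ` T"
  obtain j where j: "j \<in> mixed f" using f by (auto simp: least_mixed_def)
  have "f \<in> colorings G k" using f by (simp add: least_mixed_def)
  then have "j \<in> {1..k}" using mixed_range j by blast
  moreover have "i \<noteq> j" using j unused by (auto simp: mixed_def)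
  ultimately obtain u v where "{u, v} \<in> E" "f u = i" using least_mixed_edge[OF f i] j by blast
  then show False using E_verts unused by blast
qed

lemma least_mixed_pure_edge:
  assumes f: "least_mixed f" and ij: "i \<in> {1..k}" "j \<in> {1..k}" "i \<noteq> j"
    and p: "i \<notin> f ` T" "j \<notin> f ` T"
  shows "\<exists>u v. {u, v} \<in> E \<and> f u = i \<and> f v = j"
proof (rule ccontr)
  assume none: "\<not> ?thesis"
  have col: "f \<in> colorings G k" using f by (simp add: least_mixed_def)
  obtain f' where f': "f \<simeq> f'" "mixed f' \<subseteq> mixed f - {i, j}" "j \<notin> f' ` S"
    "\<And>u. f u \<notin> {i, j} \<Longrightarrow> f' u = f u"
    by (rule flip[OF col ij]) (use none in blast)+
  have "f' u = f u" if "u \<in> T" for u using f'(4)[of u] p that by auto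
  then have "j \<notin> f' ` T" using p by auto
  moreover have "least_mixed f'" using least_mixed_step(2)[OF f f'(1)] f'(2) by blast
  ultimately show False using least_mixed_used ij(2) f'(3) by blast
qed

text \<open>By properness each edge of \<open>E\<close> has exactly two colours, so the edges are
  sorted by colour pairs.\<close>

lemma card_E_sum:
  assumes f: "f \<in> colorings G k"
  shows "card E = (\<Sum>A | A \<subseteq> {1..k} \<and> card A = 2. card {e \<in> E. f ` e = A})"
proof -
  let ?U = "{A. A \<subseteq> {1..k} \<and> card A = 2}"
  have fin: "finite ?U" by simp
  have "f ` e \<in> ?U" if eE: "e \<in> E" for e
  proof -
    obtain u v where e: "u \<noteq> v" "e = {u, v}" using E_doubleton[OF eE] by blast
    then have uv: "{u, v} \<in> edges G" using eE E_edge by blast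
    have "f u \<noteq> f v" using col_proper[OF f uv] .
    moreover have "f u \<in> {1..k}" "f v \<in> {1..k}" using col_range[OF f] edge_verts[OF uv] by auto
    ultimately show ?thesis using e by simp
  qed
  then have E: "E = (\<Union>A\<in>?U. {e \<in> E. f ` e = A})" by blast
  have "card (\<Union>A\<in>?U. {e \<in> E. f ` e = A}) = (\<Sum>A\<in>?U. card {e \<in> E. f ` e = A})"
    using fin finite_E by (intro card_UN_disjoint) auto
  then show ?thesis using E by simp
qed

end

section \<open>Vertices of mixed colour in a doubly minimal colouring\<close>

locale minimal_mixed = almost_bipartite G k S T E for G :: "'a graph" and k S T E +
  fixes f :: "'a \<Rightarrow> nat"
  assumes least: "least_mixed f"
    and least_verts: "f \<simeq> f' \<Longrightarrow> mixed f' = mixed f \<Longrightarrow>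
      card {v \<in> S \<union> T. f v \<in> mixed f} \<le> card {v \<in> S \<union> T. f' v \<in> mixed f'}"
begin

lemma mixed_mirror: "almost_bipartite.mixed T S = mixed"
  using almost_bipartite.mixed_def[OF mirror] by (intro ext) (auto simp: mixed_def)

lemma minimal_mirror: "minimal_mixed G k T S E f"
proof -
  interpret M: almost_bipartite G k T S E by (rule mirror)
  show ?thesis
  proof
    show "M.least_mixed f" using least by (simp add: M.least_mixed_def least_mixed_def mixed_mirror)
    show "card {v \<in> T \<union> S. f v \<in> M.mixed f} \<le> card {v \<in> T \<union> S. f' v \<in> M.mixed f'}"
      if "f \<simeq> f'" "M.mixed f' = M.mixed f" for f'
      using least_verts[of f'] that by (simp add: mixed_mirror Un_commute)
  qed
qed

lemma f: "f \<in> colorings G k"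
  using least by (simp add: least_mixed_def)

definition pureS :: "nat set" where "pureS = {i \<in> {1..k}. i \<notin> f ` T}"
definition pureT :: "nat set" where "pureT = {i \<in> {1..k}. i \<notin> f ` S}"

lemma color_cases:
  assumes "i \<in> {1..k}"
  shows "i \<in> pureS \<or> i \<in> pureT \<or> i \<in> mixed f"
  using assms by (auto simp: pureS_def pureT_def mixed_def)

lemma pure_disjoint: "pureS \<inter> pureT = {}"
  using least_mixed_used[OF least] by (auto simp: pureS_def pureT_def)

lemma pureS_not_mixed: "pureS \<inter> mixed f = {}"
  by (auto simp: pureS_def mixed_def)

text \<open>No new colour becomes mixed, so the first minimality keeps the set of mixed colours
  fixed. Then \<open>v\<close> has left it and no vertex has entered, against the second minimality.
  The hypotheses cover both a single recolouring and the outcome of \<open>absorb\<close>.\<close>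

lemma no_descent:
  assumes "f \<simeq> f'" and v: "v \<in> S" "f v \<in> mixed f" "f' v \<in> pureS"
    and o: "\<And>u. u \<noteq> v \<Longrightarrow> f' u = f u \<or> f u \<in> pureS \<and> f' u \<in> pureS"
  shows False
proof -
  have T: "f' u = f u" if "u \<in> T" for u
    using o[of u] v(1) disj that by (auto simp: pureS_def)
  have S: "f' u = f u \<or> f' u \<in> pureS" for u using o[of u] v(3) by auto
  have "mixed f' \<subseteq> mixed f"
  proof
    fix c assume "c \<in> mixed f'"
    then obtain s t where st: "s \<in> S" "t \<in> T" "c = f' s" "c = f' t" by (auto simp: mixed_def)
    then have "c \<in> f ` T" using T by (metis imageI)
    then have "f' s = f s" using S[of s] st by (auto simp: pureS_def)
    then show "c \<in> mixed f" using \<open>c \<in> f ` T\<close> st by (auto simp: mixed_def)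
  qed
  then have eq: "mixed f' = mixed f" using least_mixed_step(1)[OF least assms(1)] by blast
  have "f u \<in> mixed f" "u \<noteq> v" if "f' u \<in> mixed f" for u
    using that S[of u] v(3) pureS_not_mixed by auto
  then have "{u \<in> S \<union> T. f' u \<in> mixed f'} \<subset> {u \<in> S \<union> T. f u \<in> mixed f}"
    using v eq by auto
  then have "card {u \<in> S \<union> T. f' u \<in> mixed f'} < card {u \<in> S \<union> T. f u \<in> mixed f}"
    using finite_parts by (intro psubset_card_mono) auto
  then show False using least_verts[OF assms(1) eq] by simp
qed

text \<open>Otherwise \<open>v\<close> could be recoloured to \<open>i\<close>, a descent.\<close>

lemma sees_pure:
  assumes "v \<in> S" "f v \<in> mixed f" "i \<in> pureS"
  shows "\<exists>u. {v, u} \<in> E \<and> f u = i"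
proof (rule ccontr)
  assume none: "\<not> ?thesis"
  have "f \<simeq> f(v := i)"
  proof (rule recolor[OF f])
    show "f u \<noteq> i" if "{v, u} \<in> edges G" for u
    proof
      assume "f u = i"
      then have "u \<notin> T" using assms(3) by (auto simp: pureS_def)
      then show False using edge_S[OF that assms(1)] none \<open>f u = i\<close> by blast
    qed
  qed (use assms verts in \<open>auto simp: pureS_def\<close>)
  then show False using no_descent[of "f(v := i)" v] assms by auto
qed

text \<open>The reduced outcome of \<open>absorb\<close> would give \<open>v\<close> a pure colour
  and only reshuffle \<open>a\<close> and \<open>b\<close> elsewhere, which is a descent; the other
  outcome remains.\<close>

lemma mixed_on_odd_cycle:
  assumes ab: "a \<in> pureS" "b \<in> pureS" "a \<noteq> b" and v: "v \<in> S" "f v \<in> mixed f"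
  obtains h n where "cyc h n" "odd n" "h 0 = v" "\<And>x. 0 < x \<Longrightarrow> x < n \<Longrightarrow> f (h x) \<in> {a, b}"
proof -
  have r: "a \<in> {1..k}" "b \<in> {1..k}" using ab by (auto simp: pureS_def)
  have p: "f x \<notin> {a, b}" if "x \<in> T" for x using that ab by (auto simp: pureS_def)
  have nv: "f v \<notin> {a, b}" using ab v(2) pureS_not_mixed by auto
  show thesis
  proof (rule absorb[OF f r ab(3) _ v(1) nv])
    show "f x \<notin> {a, b}" if "x \<in> T" for x using p that .
    show thesis if f': "f \<simeq> f'" "absorbed a b v f f'" for f'
    proof -
      have "f' u = f u \<or> f u \<in> pureS \<and> f' u \<in> pureS" if "u \<noteq> v" for u
      proof (cases "f u \<in> {a, b}")
        case True
        then have "f' u \<in> {a, b}" using f'(2) unfolding absorbed_def by blast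
        then show ?thesis using True ab by auto
      next
        case False
        then show ?thesis using f'(2) that unfolding absorbed_def by blast
      qed
      moreover have "f' v \<in> pureS" using f'(2) ab by (auto simp: absorbed_def)
      ultimately show thesis using no_descent[OF f'(1) v] by blast
    qed
  qed (rule that)
qed

lemma mixed_vertex: obtains v where "v \<in> S" "f v \<in> mixed f"
proof -
  have "mixed f \<noteq> {}" using least by (simp add: least_mixed_def)
  then show ?thesis using that by (auto simp: mixed_def)
qed

text \<open>A mixed vertex lies on a cycle whose other vertices have colours \<open>a\<close> and
  \<open>b\<close>. Its only two \<open>E\<close>-neighbours are on that cycle, so it cannot see a
  third pure colour.\<close>

lemma card_pureS_le: "card pureS \<le> 2"
proof (rule ccontr)
  assume "\<not> card pureS \<le> 2"
  then obtain A where A: "A \<subseteq> pureS" "card A = 3"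
    by (metis not_less_eq_eq numeral_2_eq_2 numeral_3_eq_3 obtain_subset_with_card_n)
  then obtain a b c where abc: "a \<in> pureS" "b \<in> pureS" "c \<in> pureS" "a \<noteq> b" "a \<noteq> c" "b \<noteq> c"
    by (auto simp: card_3_iff)
  obtain v where v: "v \<in> S" "f v \<in> mixed f" by (rule mixed_vertex)
  obtain h n where h: "cyc h n" "h 0 = v" "\<And>x. 0 < x \<Longrightarrow> x < n \<Longrightarrow> f (h x) \<in> {a, b}"
    using mixed_on_odd_cycle[OF abc(1,2,4) v] by metis
  obtain u where u: "{v, u} \<in> E" "f u = c" using sees_pure[OF v abc(3)] by blast
  then have "u = h 1 \<or> u = h (n - 1)" using cyc_nbr0[OF h(1)] h(2) by blast
  moreover have "n \<ge> 4" using h(1) by (simp add: cyc_def)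
  ultimately show False using h(3)[of 1] h(3)[of "n - 1"] u(2) abc by auto
qed

text \<open>On the odd cycle through a mixed vertex, all edges avoiding that vertex join the two
  pure colours, and there are at least three of them.\<close>

lemma three_pure_edges:
  assumes "card pureS = 2"
  shows "3 \<le> card {e \<in> E. f ` e = pureS}"
proof -
  obtain a b where ab: "pureS = {a, b}" "a \<noteq> b" using assms by (auto simp: card_2_iff)
  obtain v where v: "v \<in> S" "f v \<in> mixed f" by (rule mixed_vertex)
  obtain h n where h: "cyc h n" "odd n" "\<And>x. 0 < x \<Longrightarrow> x < n \<Longrightarrow> f (h x) \<in> {a, b}"
    using mixed_on_odd_cycle[of a b v] ab v by (metis insertCI)
  \<comment> \<open>Odd and at least 4 means at least 5, so the indices 1 to 4 lie strictly between
    0 and \<open>n\<close>.\<close>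
  have n: "5 \<le> n" using h(1,2) by (cases "n = 4") (auto simp: cyc_def)
  have inj: "h x = h y \<longleftrightarrow> x = y" if "x < n" "y < n" for x y
    using cyc_eq[OF h(1)] that by simp
  let ?e = "\<lambda>x. {h x, h (Suc x)}"
  have "f ` ?e x = pureS" if "x \<in> {1, 2, 3}" for x
  proof -
    have E: "?e x \<in> E" using h(1) by (simp add: cyc_def)
    have "f (h x) \<noteq> f (h (Suc x))" using col_proper[OF f] E_edge[OF E] by blast
    moreover have "f (h x) \<in> {a, b}" "f (h (Suc x)) \<in> {a, b}"
      using h(3)[of x] h(3)[of "Suc x"] that n by auto
    ultimately show ?thesis using ab by auto
  qed
  moreover have "?e x \<in> E" for x using h(1) by (simp add: cyc_def)
  ultimately have sub: "?e ` {1, 2, 3} \<subseteq> {e \<in> E. f ` e = pureS}" by blast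
  have "inj_on ?e {1, 2, 3}"
    using n by (auto simp: inj_on_def doubleton_eq_iff inj)
  then have "card (?e ` {1, 2, 3}) = 3" by (simp add: card_image)
  then show ?thesis using card_mono[OF _ sub] finite_E by simp
qed

end

section \<open>Counting the edges of \<open>E\<close> by colour pairs\<close>

locale few_edges = minimal_mixed +
  assumes few: "card E < k choose 2"
begin

lemma few_mirror: "few_edges G k T S E f"
  using minimal_mirror few by (simp add: few_edges_def few_edges_axioms_def)

lemma card_edges_of_pair: "1 \<le> card {e \<in> E. f ` e = {i, j}}" if "{u, v} \<in> E" "f u = i" "f v = j"
proof -
  have "{u, v} \<in> {e \<in> E. f ` e = {i, j}}" using that by auto
  then have "{e \<in> E. f ` e = {i, j}} \<noteq> {}" by blast
  then show ?thesis using finite_E by (simp add: Suc_le_eq card_gt_0_iff)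
qed

lemma edge_of_pair:
  assumes "i \<in> {1..k}" "j \<in> {1..k}" "i \<noteq> j" "\<not> (i \<in> pureS \<and> j \<in> pureT)" "\<not> (i \<in> pureT \<and> j \<in> pureS)"
  shows "\<exists>u v. {u, v} \<in> E \<and> f u = i \<and> f v = j"
proof -
  interpret M: few_edges G k T S E f by (rule few_mirror)
  consider "i \<in> mixed f \<or> j \<in> mixed f" | "i \<in> pureS" "j \<in> pureS" | "i \<in> pureT" "j \<in> pureT"
    using color_cases[OF assms(1)] color_cases[OF assms(2)] assms(4,5) by blast
  then show ?thesis
  proof cases
    case 1
    then show ?thesis using least_mixed_edge[OF least assms(1-3)] by blast
  next
    case 2
    then show ?thesis using least_mixed_pure_edge[OF least assms(1-3)] by (auto simp: pureS_def)
  next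
    case 3
    then show ?thesis using M.least_mixed_pure_edge[OF M.least assms(1-3)] by (auto simp: pureT_def)
  qed
qed

abbreviation color_pairs :: "nat set set" where
  "color_pairs \<equiv> {A. A \<subseteq> {1..k} \<and> card A = 2}"

text \<open>These are the only colour pairs that need not be joined by an edge of
  \<open>E\<close>.\<close>

abbreviation crossing :: "nat set set" where
  "crossing \<equiv> {A \<in> color_pairs. \<exists>x\<in>pureS. \<exists>y\<in>pureT. A = {x, y}}"

lemma card_color_pairs: "card color_pairs = k choose 2"
  using n_subsets[of "{1..k}" 2] by simp

lemma non_crossing:
  assumes "A \<in> color_pairs" "A \<notin> crossing"
  shows "1 \<le> card {e \<in> E. f ` e = A}"
proof -
  obtain i j where A: "A = {i, j}" "i \<noteq> j" using assms by (auto simp: card_2_iff)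
  have r: "i \<in> {1..k}" "j \<in> {1..k}" using assms A by auto
  have nc: "A \<noteq> {x, y}" if "x \<in> pureS" "y \<in> pureT" for x y
  proof
    assume "A = {x, y}"
    then have "\<exists>x\<in>pureS. \<exists>y\<in>pureT. A = {x, y}" using that by (intro bexI)
    then show False using assms by simp
  qed
  have "\<not> (i \<in> pureS \<and> j \<in> pureT)" using nc[of i j] A(1) by auto
  moreover have "\<not> (i \<in> pureT \<and> j \<in> pureS)" using nc[of j i] A(1) by (auto simp: insert_commute)
  ultimately obtain u v where "{u, v} \<in> E" "f u = i" "f v = j"
    using edge_of_pair[OF r A(2)] by blast
  then show ?thesis using card_edges_of_pair A by simp
qed

lemma finite_color_pairs: "finite color_pairs"
  by simp

text \<open>Otherwise each of the \<open>k choose 2\<close> colour pairs would have its own edge. In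
  consequence both sides have a pure colour.\<close>

lemma crossing_nonempty: "crossing \<noteq> {}"
proof
  assume none: "crossing = {}"
  have "card color_pairs = (\<Sum>A\<in>color_pairs. 1)" by simp
  also have "\<dots> \<le> (\<Sum>A\<in>color_pairs. card {e \<in> E. f ` e = A})"
  proof (rule sum_mono)
    show "1 \<le> card {e \<in> E. f ` e = A}" if "A \<in> color_pairs" for A
      using non_crossing[OF that] none by blast
  qed
  also have "\<dots> = card E" using card_E_sum[OF f] by simp
  finally show False using few card_color_pairs by simp
qed

lemma finite_pure: "finite pureS" "finite pureT"
  by (auto simp: pureS_def pureT_def)

lemma card_crossing: "card crossing \<le> card pureS * card pureT"
proof -
  have "crossing \<subseteq> (\<lambda>(x, y). {x, y}) ` (pureS \<times> pureT)" by auto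
  then have "card crossing \<le> card ((\<lambda>(x, y). {x, y}) ` (pureS \<times> pureT))"
    using finite_pure by (intro card_mono) auto
  also have "\<dots> \<le> card (pureS \<times> pureT)" using finite_pure by (intro card_image_le) auto
  finally show ?thesis by (simp only: card_cartesian_product)
qed

text \<open>Crediting each crossing pair with one extra unit makes every summand at least 1, so that
  surplus edges can be compared term by term.\<close>

lemma sum_with_crossing:
  "(\<Sum>A\<in>color_pairs. card {e \<in> E. f ` e = A} + (if A \<in> crossing then 1 else 0)) = card E + card crossing"
proof -
  have "(\<Sum>A\<in>color_pairs. if A \<in> crossing then 1 else 0 :: nat) = card crossing"
    by (rule indicator_sum) auto
  then show ?thesis unfolding sum.distrib card_E_sum[OF f] by simp
qed

text \<open>Let \<open>s\<close> be the number of sides with two pure colours. Such a pair of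
  colours has at least three edges, a surplus of two, and the count yields
  \<open>2 * s < card pureS * card pureT\<close>. Both factors are 1 or 2, and the inequality fails
  as soon as one of them is 2.\<close>

lemma card_pure: "card pureS = 1" "card pureT = 1"
proof -
  interpret M: few_edges G k T S E f by (rule few_mirror)
  have MS: "M.pureS = pureT" by (simp add: M.pureS_def pureT_def)
  \<comment> \<open>Empty or a singleton, so that the cardinalities act as indicators and the
    surplus becomes a sum over colour pairs.\<close>
  let ?s = "if card pureS = 2 then {pureS} else {}" and ?t = "if card pureT = 2 then {pureT} else {}"
  have sub: "?s \<subseteq> color_pairs" "?t \<subseteq> color_pairs" by (auto simp: pureS_def pureT_def)
  have cr: "A \<noteq> pureS" "A \<noteq> pureT" if "A \<in> crossing" for A
    using that pure_disjoint by auto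
  have "(\<Sum>A\<in>color_pairs. 1 + 2 * ((if A \<in> ?s then 1 else 0) + (if A \<in> ?t then 1 else 0)))
      = card color_pairs + 2 * (card ?s + card ?t)"
    unfolding sum.distrib sum_distrib_left[symmetric] indicator_sum[OF finite_color_pairs sub(1)]
      indicator_sum[OF finite_color_pairs sub(2)] by simp
  then have "card color_pairs + 2 * (card ?s + card ?t)
      = (\<Sum>A\<in>color_pairs. 1 + 2 * ((if A \<in> ?s then 1 else 0) + (if A \<in> ?t then 1 else 0)))"
    by (rule sym)
  also have "\<dots> \<le> (\<Sum>A\<in>color_pairs. card {e \<in> E. f ` e = A} + (if A \<in> crossing then 1 else 0))"
  proof (rule sum_mono)
    fix A assume A: "A \<in> color_pairs"
    show "1 + 2 * ((if A \<in> ?s then 1 else 0) + (if A \<in> ?t then 1 else 0))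
      \<le> card {e \<in> E. f ` e = A} + (if A \<in> crossing then 1 else 0)"
    proof (cases "A \<in> crossing")
      case True
      then have "A \<notin> ?s" "A \<notin> ?t" using cr[OF True] by simp_all
      then show ?thesis using True by simp
    next
      case False
      have A2: "A \<noteq> {}" using A by auto
      have s: "3 \<le> card {e \<in> E. f ` e = A}" if "A \<in> ?s"
      proof -
        have "A = pureS" "card pureS = 2" using that by (simp_all split: if_splits)
        then show ?thesis using three_pure_edges by simp
      qed
      have t: "3 \<le> card {e \<in> E. f ` e = A}" if "A \<in> ?t"
      proof -
        have "A = M.pureS" "card M.pureS = 2" using that MS by (simp_all split: if_splits)
        then show ?thesis using M.three_pure_edges by simp
      qed
      have arith: "1 + 2 * ((if p then 1 else 0) + (if q then 1 else 0)) \<le> c + d"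
        if "\<not> (p \<and> q)" "1 \<le> c" "p \<Longrightarrow> 3 \<le> c" "q \<Longrightarrow> 3 \<le> c" for p q and c d :: nat
        using that by auto
      have "\<not> (A \<in> ?s \<and> A \<in> ?t)"
      proof
        assume *: "A \<in> ?s \<and> A \<in> ?t"
        have "A = pureS" using conjunct1[OF *] by (simp split: if_splits)
        moreover have "A = pureT" using conjunct2[OF *] by (simp split: if_splits)
        ultimately have "A = pureS" "A = pureT" .
        then show False using pure_disjoint A2 by blast
      qed
      moreover have "1 \<le> card {e \<in> E. f ` e = A}" by (rule non_crossing[OF A False])
      ultimately show ?thesis using s t by (rule arith)
    qed
  qed
  also have "\<dots> = card E + card crossing" by (rule sum_with_crossing)
  finally have le: "card color_pairs + 2 * (card ?s + card ?t) \<le> card E + card crossing" .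
  have "card pureS \<noteq> 0" "card pureT \<noteq> 0"
    using crossing_nonempty finite_pure by auto
  moreover have "card pureS \<le> 2" "card pureT \<le> 2"
    using card_pureS_le M.card_pureS_le MS by auto
  ultimately have ct: "card pureS \<in> {1, 2}" "card pureT \<in> {1, 2}" by auto
  have "card color_pairs + 2 * (card ?s + card ?t) < card color_pairs + card pureS * card pureT"
    using le few card_color_pairs card_crossing by linarith
  then show "card pureS = 1" "card pureT = 1" using ct by auto
qed

lemma edge_not_crossing:
  assumes "{u, v} \<in> E"
  shows "\<not> (f u \<in> pureS \<and> f v \<in> pureT)"
proof
  assume p: "f u \<in> pureS \<and> f v \<in> pureT"
  have "u \<in> S \<union> T" "v \<in> S \<union> T" using E_verts[OF assms] by auto
  then have "u \<in> S" "v \<in> T" using p by (auto simp: pureS_def pureT_def)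
  then show False using E_S[OF assms] disj by auto
qed

text \<open>There is now at most one crossing pair, so a single repeated colour pair would already
  raise \<open>card E\<close> to \<open>k choose 2\<close>.\<close>

lemma unique_edges:
  assumes e: "e \<in> E" "e' \<in> E" "f ` e = f ` e'"
  shows "e = e'"
proof (rule ccontr)
  assume neq: "e \<noteq> e'"
  let ?A = "f ` e"
  obtain u v where uv: "u \<noteq> v" "e = {u, v}" using E_doubleton[OF e(1)] by blast
  have uvE: "{u, v} \<in> E" using e(1) uv by simp
  have "f u \<noteq> f v" using col_proper[OF f] E_edge[OF uvE] by blast
  moreover have "f u \<in> {1..k}" "f v \<in> {1..k}"
    using col_range[OF f] edge_verts[OF E_edge[OF uvE]] by auto
  ultimately have A: "?A \<in> color_pairs" using uv by simp
  have nc: "?A \<notin> crossing"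
    using edge_not_crossing[OF uvE] edge_not_crossing[OF E_sym[OF uvE]] uv(2)
    by (auto simp: doubleton_eq_iff)
  have two: "2 \<le> card {e \<in> E. f ` e = ?A}"
  proof -
    have "card {e, e'} \<le> card {e \<in> E. f ` e = ?A}"
      using e finite_E by (intro card_mono) auto
    then show ?thesis using neq by simp
  qed
  have "(\<Sum>B\<in>color_pairs. 1 + (if B \<in> {?A} then 1 else 0)) = card color_pairs + 1"
    unfolding sum.distrib using indicator_sum[OF finite_color_pairs, of "{?A}"] A by simp
  moreover have "(\<Sum>B\<in>color_pairs. 1 + (if B \<in> {?A} then 1 else 0)) \<le>
      (\<Sum>B\<in>color_pairs. card {e \<in> E. f ` e = B} + (if B \<in> crossing then 1 else 0))"
  proof (rule sum_mono)
    show "1 + (if B \<in> {?A} then 1 else 0) \<le> card {e \<in> E. f ` e = B} + (if B \<in> crossing then 1 else 0)"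
      if B: "B \<in> color_pairs" for B
    proof (cases "B = ?A")
      case True
      then show ?thesis using two by simp
    next
      case False
      then show ?thesis using non_crossing[OF B] by (cases "B \<in> crossing") simp_all
    qed
  qed
  ultimately have "card color_pairs + 1 \<le> card E + card crossing"
    using sum_with_crossing by linarith
  moreover have "card crossing \<le> 1" using card_crossing card_pure by simp
  ultimately show False using few card_color_pairs by linarith
qed

end

section \<open>Edges of \<open>E\<close> between mixed vertices\<close>

context almost_bipartite
begin

text \<open>Paths and complete bipartite graphs have no triangle; on a cycle, length at least 4
  keeps the two neighbours of \<open>x\<close> from being adjacent.\<close>

lemma no_triangle:
  assumes "{x, y} \<in> E" "{y, z} \<in> E" "{x, z} \<in> E"
  shows False
proof -
  have neq: "x \<noteq> y" "y \<noteq> z" "x \<noteq> z" using E_neq assms by auto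
  have "x \<in> \<Union>E" using assms(1) by blast
  then show False
  proof (cases rule: component_shape)
    case (1 p i)
    have eq: "p ! m = p ! n \<longleftrightarrow> m = n" if "m < length p" "n < length p" for m n
      using 1(1) that by (simp add: pth_def nth_eq_iff_index_eq)
    have "(Suc i < length p \<and> u = p ! Suc i) \<or> (i > 0 \<and> u = p ! (i - 1))" if "{x, u} \<in> E" for u
      using pth_nbr[OF 1(1,2)] that 1(3) by simp
    from this[OF assms(1)] this[OF assms(3)] neq(2)
    have i: "Suc i < length p" "i > 0" "{y, z} = {p ! Suc i, p ! (i - 1)}" by auto
    then have "{p ! Suc i, p ! (i - 1)} \<in> E" using assms(2) by simp
    from pth_nbr[OF 1(1) i(1) this] show False using i eq by auto
  next
    case (2 h n)
    have n: "n \<ge> 4" using 2(1) by (simp add: cyc_def)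
    have eq: "h a = h b \<longleftrightarrow> a = b" if "a < n" "b < n" for a b
      using cyc_eq[OF 2(1)] that by simp
    have "u = h 1 \<or> u = h (n - 1)" if "{x, u} \<in> E" for u
      using cyc_nbr0[OF 2(1)] 2(2) that by simp
    from this[OF assms(1)] this[OF assms(3)] neq(2)
    have "{y, z} = {h 1, h (n - 1)}" by auto
    then have "{h (Suc 0), h (n - 1)} \<in> E" using assms(2) by simp
    from cyc_nbr[OF 2(1) this] show False
      using n eq[of "n - 1" "Suc (Suc 0)"] eq[of "n - 1" 0] by auto
  next
    case (3 X Y)
    have "y \<in> Y" "z \<in> Y" using cbip_nbr[OF 3(1,2)] assms by auto
    moreover have "z \<in> X" using cbip_nbr[OF cbip_sym[OF 3(1)] \<open>y \<in> Y\<close> assms(2)] .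
    ultimately show False using 3(1) by (auto simp: cbip_def)
  qed
qed

end

context few_edges
begin

text \<open>The vertex \<open>v\<close> also sees a pure colour \<open>a\<close>, at
  \<open>u\<close>, so it would have three \<open>E\<close>-neighbours, too many for a path or a
  cycle. In a complete bipartite component \<open>x\<close> sees colour \<open>a\<close> at some
  \<open>w\<close> in the part of \<open>v\<close>, and \<open>w\<close> is adjacent to
  \<open>u\<close>, also of colour \<open>a\<close>.\<close>

lemma mixed_matching:
  assumes S: "v \<in> S" and E: "{v, x} \<in> E" "{v, y} \<in> E"
    and m: "f v \<in> mixed f" "f x \<in> mixed f" "f y \<in> mixed f"
  shows "x = y"
proof (rule ccontr)
  assume xy: "x \<noteq> y"
  obtain a where a: "a \<in> pureS" using card_pure(1) by (metis card_1_singletonE insertI1)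
  have am: "a \<notin> mixed f" using a pureS_not_mixed by blast
  obtain u where u: "{v, u} \<in> E" "f u = a" using sees_pure[OF S m(1) a] by blast
  have ne: "u \<noteq> x" "u \<noteq> y" using u m am by auto
  have "v \<in> \<Union>E" using E(1) by blast
  then show False
  proof (cases rule: component_shape)
    case (1 p i)
    have "(Suc i < length p \<and> w = p ! Suc i) \<or> (i > 0 \<and> w = p ! (i - 1))" if "{v, w} \<in> E" for w
      using pth_nbr[OF 1(1,2)] that 1(3) by simp
    from this[OF E(1)] this[OF E(2)] this[OF u(1)] show False using xy ne by auto
  next
    case (2 h n)
    have "w = h 1 \<or> w = h (n - 1)" if "{v, w} \<in> E" for w
      using cyc_nbr0[OF 2(1)] 2(2) that by simp
    from this[OF E(1)] this[OF E(2)] this[OF u(1)] show False using xy ne by auto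
  next
    case (3 X Y)
    have xS: "x \<in> S" using E_S[OF E(1) S] .
    obtain w where w: "{x, w} \<in> E" "f w = a" using sees_pure[OF xS m(2) a] by blast
    have "x \<in> Y" "u \<in> Y" using cbip_nbr[OF 3(1,2)] E(1) u(1) by auto
    moreover have "w \<in> X" using cbip_nbr[OF cbip_sym[OF 3(1)] \<open>x \<in> Y\<close> w(1)] .
    ultimately have "{w, u} \<in> E" using 3(1) by (simp add: cbip_def)
    then show False using col_proper[OF f E_edge] u(2) w(2) by auto
  qed
qed

text \<open>Both vertices have an \<open>E\<close>-edge to the pure colour \<open>a\<close>, and
  these edges have the same colour pair, so they coincide by \<open>unique_edges\<close>.\<close>

lemma mixed_unique:
  assumes "v \<in> S" "w \<in> S" "f v = f w" "f v \<in> mixed f"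
  shows "v = w"
proof -
  obtain a where a: "a \<in> pureS" using card_pure(1) by (metis card_1_singletonE insertI1)
  have am: "f v \<noteq> a" using a pureS_not_mixed assms(4) by blast
  obtain x where x: "{v, x} \<in> E" "f x = a" using sees_pure[OF assms(1,4) a] by blast
  obtain y where y: "{w, y} \<in> E" "f y = a" using sees_pure[OF assms(2) _ a] assms(3,4) by auto
  have "{v, x} = {w, y}" using unique_edges[OF x(1) y(1)] x(2) y(2) assms(3) by simp
  then show ?thesis using am x(2) y(2) by (auto simp: doubleton_eq_iff)
qed

text \<open>The side is an argument, so that the mirrored interpretation speaks about the same
  predicate.\<close>

definition mixed_edge_in :: "'a set \<Rightarrow> nat \<Rightarrow> nat \<Rightarrow> bool" where
  "mixed_edge_in R i j \<longleftrightarrow> (\<exists>u v. {u, v} \<in> E \<and> u \<in> R \<and> f u = i \<and> f v = j)"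

end

subsection \<open>The exceptional case of four colours\<close>

text \<open>Here \<open>E\<close> consists of the path \<open>u v v' u'\<close> in \<open>S\<close> and of the edges \<open>x w\<close>, \<open>x' w'\<close> in \<open>T\<close>;
  \<open>x = x'\<close> is possible.\<close>

locale exceptional = almost_bipartite G k S T E for G :: "'a graph" and k S T E +
  fixes f g :: "'a \<Rightarrow> nat" and a b i j :: nat and v v' u u' w w' x x' :: 'a
  assumes f: "f \<in> colorings G k" and g: "g \<in> colorings G 3"
    and colors: "{1..k} = {a, b, i, j}" and distinct: "distinct [a, b, i, j]"
    and inS: "v \<in> S" "v' \<in> S" "u \<in> S" "u' \<in> S"
    and inT: "w \<in> T" "w' \<in> T" "x \<in> T" "x' \<in> T"
    and fv: "f v = i" "f v' = j" and fu: "f u = a" "f u' = a"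
    and fw: "f w = i" "f w' = j" and fx: "f x = b" "f x' = b"
    and only_i: "f z = i \<Longrightarrow> z \<in> S \<union> T \<Longrightarrow> z = v \<or> z = w"
    and only_j: "f z = j \<Longrightarrow> z \<in> S \<union> T \<Longrightarrow> z = v' \<or> z = w'"
    and only_a: "z \<in> T \<Longrightarrow> f z \<noteq> a" and only_b: "z \<in> S \<Longrightarrow> f z \<noteq> b"
    and E_eq: "E = {{v, v'}, {u, v}, {u', v'}, {x, w}, {x', w'}}"
    and uu': "u \<noteq> u'"
    and two_mixed: "f \<simeq> f' \<Longrightarrow> 2 \<le> card (mixed f')"
begin

lemma cdist: "a \<noteq> b" "a \<noteq> i" "a \<noteq> j" "b \<noteq> i" "b \<noteq> j" "i \<noteq> j"
  "b \<noteq> a" "i \<noteq> a" "j \<noteq> a" "i \<noteq> b" "j \<noteq> b" "j \<noteq> i"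
  using distinct by auto

lemma crange: "a \<in> {1..k}" "b \<in> {1..k}" "i \<in> {1..k}" "j \<in> {1..k}"
  unfolding colors by auto

text \<open>The configuration is symmetric under exchanging \<open>i\<close> with \<open>j\<close>
  and primed with unprimed vertices, so each adjacency found below holds in two versions.\<close>

lemma exchange: "exceptional G k S T E f g a b j i v' v u' u w' w x' x"
proof
  show "E = {{v', v}, {u', v'}, {u, v}, {x', w'}, {x, w}}"
    unfolding E_eq by (auto simp: insert_commute)
qed (use f g colors distinct inS inT fv fu fw fx only_i only_j only_a only_b uu' two_mixed in auto)

lemma vdist: "v \<noteq> v'" "v \<noteq> u" "v \<noteq> u'" "v' \<noteq> u" "v' \<noteq> u'"
  "w \<noteq> w'" "w \<noteq> x" "w \<noteq> x'" "w' \<noteq> x" "w' \<noteq> x'"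
proof -
  have neq: "y \<noteq> z" if "f y \<noteq> f z" for y z using that by blast
  show "v \<noteq> v'" "v \<noteq> u" "v \<noteq> u'" "v' \<noteq> u" "v' \<noteq> u'"
    "w \<noteq> w'" "w \<noteq> x" "w \<noteq> x'" "w' \<noteq> x" "w' \<noteq> x'"
    by (rule neq, simp add: fv fu fw fx cdist)+
qed

lemma sides_neq: "w \<notin> S" "w' \<notin> S" "x \<notin> S" "x' \<notin> S" "v \<notin> T" "v' \<notin> T" "u \<notin> T" "u' \<notin> T"
  using inS inT disj by auto

text \<open>Both orientations are stated so that they serve as rewrite rules when checking which
  sides a modified colouring uses.\<close>

lemma only_i_side: "z \<in> S \<Longrightarrow> f z = i \<longleftrightarrow> z = v" "z \<in> S \<Longrightarrow> i = f z \<longleftrightarrow> z = v"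
  "z \<in> T \<Longrightarrow> f z = i \<longleftrightarrow> z = w" "z \<in> T \<Longrightarrow> i = f z \<longleftrightarrow> z = w"
  using only_i[of z] fv fw sides_neq by auto

lemma only_j_side: "z \<in> S \<Longrightarrow> f z = j \<longleftrightarrow> z = v'" "z \<in> S \<Longrightarrow> j = f z \<longleftrightarrow> z = v'"
  "z \<in> T \<Longrightarrow> f z = j \<longleftrightarrow> z = w'" "z \<in> T \<Longrightarrow> j = f z \<longleftrightarrow> z = w'"
  using only_j[of z] fv fw sides_neq by auto

lemma only_ab_side: "z \<in> T \<Longrightarrow> f z = a \<longleftrightarrow> False" "z \<in> T \<Longrightarrow> a = f z \<longleftrightarrow> False"
  "z \<in> S \<Longrightarrow> f z = b \<longleftrightarrow> False" "z \<in> S \<Longrightarrow> b = f z \<longleftrightarrow> False"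
  using only_a[of z] only_b[of z] by auto

lemma nbr_v: "{v, z} \<in> E \<Longrightarrow> z = v' \<or> z = u"
  unfolding E_eq using vdist sides_neq inS inT by (auto simp: doubleton_eq_iff)

lemma nbr_u: "{u, z} \<in> E \<Longrightarrow> z = v"
  unfolding E_eq using vdist sides_neq inS inT uu' by (auto simp: doubleton_eq_iff)

lemma nbr_w: "{w, z} \<in> E \<Longrightarrow> z = x"
  unfolding E_eq using vdist sides_neq inS inT by (auto simp: doubleton_eq_iff)

lemma nbr_x: "{x, z} \<in> E \<Longrightarrow> z = w \<or> x = x' \<and> z = w'"
  unfolding E_eq using vdist sides_neq inS inT by (auto simp: doubleton_eq_iff)

lemma edge_a: "{s, z} \<in> edges G \<Longrightarrow> s \<in> S \<Longrightarrow> f z = a \<Longrightarrow> {s, z} \<in> E"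
  using edge_S only_a by blast

lemma edge_T: "{s, z} \<in> edges G \<Longrightarrow> s \<in> T \<Longrightarrow> z \<notin> S \<Longrightarrow> {s, z} \<in> E"
  using side_E[of "{s, z}"] edge_verts[of s z] verts by auto

lemma edge_b: "{s, z} \<in> edges G \<Longrightarrow> s \<in> T \<Longrightarrow> f z = b \<Longrightarrow> {s, z} \<in> E"
  using edge_T only_b by blast

text \<open>Each of \<open>p\<close>, \<open>q\<close>, \<open>r\<close> is missing from one side,
  so only \<open>c\<close> can still be mixed, against \<open>two_mixed\<close>.\<close>

lemma one_mixed_False:
  assumes "f \<simeq> f'" "\<forall>z\<in>P. f' z \<noteq> p" "\<forall>z\<in>Q. f' z \<noteq> q" "\<forall>z\<in>R. f' z \<noteq> r"
    and "P \<in> {S, T}" "Q \<in> {S, T}" "R \<in> {S, T}" "{a, b, i, j} = {c, p, q, r}"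
  shows False
proof -
  have "mixed f' \<subseteq> {c, p, q, r}" using mixed_range[OF keq_col[OF assms(1)]] colors assms(8) by simp
  moreover have "p \<notin> mixed f'" "q \<notin> mixed f'" "r \<notin> mixed f'"
    using assms(2-7) by (auto simp: mixed_def)
  ultimately have "mixed f' \<subseteq> {c}" by blast
  then have "card (mixed f') \<le> card {c}" by (intro card_mono) auto
  then show False using two_mixed[OF assms(1)] by simp
qed

lemma config_verts: "v \<in> verts G" "v' \<in> verts G" "u \<in> verts G" "u' \<in> verts G"
  "w \<in> verts G" "w' \<in> verts G" "x \<in> verts G" "x' \<in> verts G"
  using inS inT verts by auto

lemma in_verts: "{y, z} \<in> edges G \<Longrightarrow> z \<in> S \<union> T"
  using edge_verts verts by blast

text \<open>Otherwise \<open>u\<close> can take colour \<open>j\<close>. It was the only vertex of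
  colour \<open>a\<close> seen by \<open>v\<close>, so \<open>v\<close> can then take
  \<open>a\<close>, and \<open>i\<close> disappears from \<open>S\<close>.\<close>

lemma edge_uw': "{u, w'} \<in> edges G"
proof (rule ccontr)
  assume no: "{u, w'} \<notin> edges G"
  have f1: "f \<simeq> f(u := j)"
  proof (rule recolor[OF f config_verts(3) crange(4)])
    show "f z \<noteq> j" if e: "{u, z} \<in> edges G" for z
    proof
      assume "f z = j"
      then have "z = v'" using only_j in_verts[OF e] e no by auto
      then have "{u, v'} \<in> E" using edge_S[OF e inS(3)] sides_neq by simp
      then show False using nbr_u vdist by auto
    qed
  qed
  let ?f = "(f(u := j))(v := a)"
  have "f(u := j) \<simeq> ?f"
  proof (rule recolor[OF keq_col[OF f1] config_verts(1) crange(1)])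
    show "(f(u := j)) z \<noteq> a" if e: "{v, z} \<in> edges G" for z
    proof
      assume z: "(f(u := j)) z = a"
      have zu: "z \<noteq> u"
      proof
        assume "z = u"
        then show False using z cdist(9) by simp
      qed
      then have za: "f z = a" using z by simp
      have "z = v' \<or> z = u" using nbr_v edge_a[OF e inS(1) za] .
      then show False using zu za fv(2) cdist(3) by auto
    qed
  qed
  then have "f \<simeq> ?f" using keq_trans[OF f1] by blast
  moreover have "\<forall>z\<in>S. ?f z \<noteq> i" by (auto simp: cdist sides_neq only_i_side)
  moreover have "\<forall>z\<in>T. ?f z \<noteq> a" by (auto simp: cdist sides_neq only_ab_side)
  moreover have "\<forall>z\<in>S. ?f z \<noteq> b" by (auto simp: cdist sides_neq only_ab_side)
  ultimately show False
    by (rule one_mixed_False[where c = j]) auto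
qed

text \<open>Otherwise \<open>w\<close> can take colour \<open>j\<close>, and \<open>i\<close>
  disappears from \<open>T\<close>.\<close>

lemma edge_v'w: "{v', w} \<in> edges G"
proof (rule ccontr)
  assume no: "{v', w} \<notin> edges G"
  let ?f = "f(w := j)"
  have "f \<simeq> ?f"
  proof (rule recolor[OF f config_verts(5) crange(4)])
    show "f z \<noteq> j" if e: "{w, z} \<in> edges G" for z
    proof
      assume "f z = j"
      moreover have "z \<noteq> v'" using e no by (auto simp: insert_commute)
      ultimately have "z = w'" using only_j in_verts[OF e] by blast
      then have "{w, w'} \<in> E" using edge_T[OF e inT(1)] sides_neq by simp
      then show False using nbr_w vdist by auto
    qed
  qed
  moreover have "\<forall>z\<in>T. ?f z \<noteq> i" by (auto simp: cdist sides_neq only_i_side)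
  moreover have "\<forall>z\<in>T. ?f z \<noteq> a" by (auto simp: cdist sides_neq only_ab_side)
  moreover have "\<forall>z\<in>S. ?f z \<noteq> b" by (auto simp: cdist sides_neq only_ab_side)
  ultimately show False
    by (rule one_mixed_False[where c = j]) auto
qed

text \<open>Otherwise \<open>x\<close>, which is not adjacent to \<open>w'\<close> when
  \<open>x\<close> and \<open>x'\<close> differ, can take colour \<open>j\<close>; then
  \<open>w\<close> can take \<open>b\<close>, and \<open>i\<close> disappears from
  \<open>T\<close>.\<close>

lemma edge_xv'_of_distinct:
  assumes "x \<noteq> x'"
  shows "{x, v'} \<in> edges G"
proof (rule ccontr)
  assume no: "{x, v'} \<notin> edges G"
  have f1: "f \<simeq> f(x := j)"
  proof (rule recolor[OF f config_verts(7) crange(4)])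
    show "f z \<noteq> j" if e: "{x, z} \<in> edges G" for z
    proof
      assume "f z = j"
      then have "z = w'" using only_j in_verts[OF e] e no by auto
      then have "{x, w'} \<in> E" using edge_T[OF e inT(3)] sides_neq by simp
      then show False using nbr_x vdist assms by auto
    qed
  qed
  let ?f = "(f(x := j))(w := b)"
  have "f(x := j) \<simeq> ?f"
  proof (rule recolor[OF keq_col[OF f1] config_verts(5) crange(2)])
    show "(f(x := j)) z \<noteq> b" if e: "{w, z} \<in> edges G" for z
    proof
      assume z: "(f(x := j)) z = b"
      have zx: "z \<noteq> x"
      proof
        assume "z = x"
        then show False using z cdist(11) by simp
      qed
      then have zb: "f z = b" using z by simp
      show False using nbr_w[OF edge_b[OF e inT(1) zb]] zx by simp
    qed
  qed
  then have "f \<simeq> ?f" using keq_trans[OF f1] by blast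
  moreover have "\<forall>z\<in>T. ?f z \<noteq> i" by (auto simp: cdist sides_neq only_i_side)
  moreover have "\<forall>z\<in>T. ?f z \<noteq> a" by (auto simp: cdist sides_neq only_ab_side)
  moreover have "\<forall>z\<in>S. ?f z \<noteq> b" by (auto simp: cdist sides_neq only_ab_side)
  ultimately show False
    by (rule one_mixed_False[where c = j]) auto
qed

lemma g_edge: "{y, z} \<in> edges G \<Longrightarrow> g y \<noteq> g z"
  using g by (auto simp: colorings_def)

lemma g_range: "z \<in> verts G \<Longrightarrow> g z \<in> {1, 2, 3}"
  using g by (auto simp: colorings_def PiE_iff dest!: bspec)

lemma in_E: "{v, v'} \<in> E" "{u, v} \<in> E" "{u', v'} \<in> E" "{x, w} \<in> E" "{x', w'} \<in> E"
  unfolding E_eq by auto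

text \<open>Without the edge to \<open>v\<close>, the vertices \<open>w\<close> and \<open>x\<close>
  form a component for the colours \<open>b\<close> and \<open>i\<close>.\<close>

lemma swap_wx:
  assumes no: "{x, v} \<notin> edges G"
  shows "f \<simeq> (f(w := b))(x := i)"
proof -
  have "f \<simeq> (\<lambda>z. if z \<in> {w, x} then transpose b i (f z) else f z)"
  proof (rule swap_closed[OF f crange(2,3) cdist(4)])
    show "z \<in> {w, x}" if "y \<in> {w, x}" "{y, z} \<in> edges G" "f z \<in> {b, i}" for y z
    proof (cases "f z = b")
      case True
      then have "{y, z} \<in> E" using edge_b that(1,2) inT by auto
      then show ?thesis using that(1) nbr_w nbr_x True fw cdist by auto
    next
      case False
      then have "z = v \<or> z = w" using that(3) only_i in_verts[OF that(2)] by auto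
      moreover have "\<not> (y = w \<and> z = v)" using col_proper[OF f that(2)] fv fw by auto
      ultimately show ?thesis using that(1,2) no by auto
    qed
  qed (use config_verts fw fx in auto)
  also have "(\<lambda>z. if z \<in> {w, x} then transpose b i (f z) else f z) = (f(w := b))(x := i)"
    using fw fx vdist by (auto simp: fun_eq_iff)
  finally show ?thesis .
qed

text \<open>Otherwise \<open>w\<close> and \<open>x\<close> can exchange colours. If
  \<open>x = x'\<close>, then \<open>w'\<close> becomes free for \<open>b\<close> and
  \<open>j\<close> disappears from \<open>T\<close>; if not, the adjacencies of the old and the new
  configuration together contradict the 3-colouring \<open>g\<close>.\<close>

lemma edge_xv: "{x, v} \<in> edges G"
proof (rule ccontr)
  assume no: "{x, v} \<notin> edges G"
  interpret X: exceptional G k S T E f g a b j i v' v u' u w' w x' x by (rule exchange)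
  let ?f = "(f(w := b))(x := i)"
  note f1 = swap_wx[OF no]
  show False
  proof (cases "x = x'")
    case True
    let ?g = "?f(w' := b)"
    have "?f \<simeq> ?g"
    proof (rule recolor[OF keq_col[OF f1] config_verts(6) crange(2)])
      show "?f z \<noteq> b" if e: "{w', z} \<in> edges G" for z
      proof
        assume z: "?f z = b"
        have "z \<notin> S"
        proof
          assume "z \<in> S"
          then have "z \<noteq> w" "z \<noteq> x" "f z \<noteq> b" using only_b sides_neq by auto
          then show False using z by simp
        qed
        then have "z = x" using edge_T[OF e inT(2)] X.nbr_w True by blast
        then show False using z cdist by simp
      qed
    qed
    then have "f \<simeq> ?g" using keq_trans[OF f1] by blast
    moreover have "\<forall>z\<in>T. ?g z \<noteq> j" by (auto simp: cdist sides_neq only_j_side)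
    moreover have "\<forall>z\<in>T. ?g z \<noteq> a" by (auto simp: cdist sides_neq only_ab_side)
    moreover have "\<forall>z\<in>S. ?g z \<noteq> b" by (auto simp: cdist sides_neq only_ab_side)
    ultimately show False
      by (rule one_mixed_False[where c = i]) auto
  next
    case False
    \<comment> \<open>Now \<open>x\<close> carries \<open>i\<close> and \<open>w\<close> carries
      \<open>b\<close>, so these two exchange their places in the configuration.\<close>
    have "exceptional G k S T E ?f g a b i j v v' u u' x w' w x'"
    proof
      show "?f \<in> colorings G k" using keq_col[OF f1] .
      show "z = v \<or> z = x" if "?f z = i" "z \<in> S \<union> T" for z
        using that only_i cdist by (auto split: if_splits)
      show "z = v' \<or> z = w'" if "?f z = j" "z \<in> S \<union> T" for z
        using that only_j cdist by (auto split: if_splits)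
      show "?f z \<noteq> a" if "z \<in> T" for z using only_a that cdist by auto
      show "?f z \<noteq> b" if "z \<in> S" for z using only_b that cdist sides_neq by auto
      show "E = {{v, v'}, {u, v}, {u', v'}, {w, x}, {x', w'}}"
        unfolding E_eq by (simp add: insert_commute)
      show "2 \<le> card (mixed f')" if "?f \<simeq> f'" for f'
        using two_mixed keq_trans[OF f1 that] .
      show "?f v = i" "?f v' = j" "?f u = a" "?f u' = a" "?f x = i" "?f w' = j" "?f w = b" "?f x' = b"
        using fv fu fw fx sides_neq inS inT vdist False by auto
    qed (use g colors distinct inS inT uu' in auto)
    then interpret N: exceptional G k S T E ?f g a b i j v v' u u' x w' w x' .
    interpret NX: exceptional G k S T E ?f g a b j i v' v u' u w' x x' w by (rule N.exchange)
    \<comment> \<open>The vertices \<open>u'\<close>, \<open>v'\<close>, \<open>x\<close>,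
      \<open>w\<close> are pairwise adjacent, too many for three colours.\<close>
    have "g u' \<noteq> g x" "g v' \<noteq> g x" "g u' \<noteq> g w" "g v' \<noteq> g w" "g u' \<noteq> g v'" "g x \<noteq> g w"
      using g_edge[OF NX.edge_uw'] g_edge[OF N.edge_v'w] g_edge[OF X.edge_uw'] g_edge[OF edge_v'w]
        g_edge[OF E_edge[OF in_E(3)]] g_edge[OF E_edge[OF in_E(4)]] by auto
    then show False using g_range[OF config_verts(4)] g_range[OF config_verts(7)] g_range[OF config_verts(5)] g_range[OF config_verts(2)] by auto
  qed
qed

lemma edge_xv': "{x, v'} \<in> edges G"
proof (cases "x = x'")
  case True
  interpret X: exceptional G k S T E f g a b j i v' v u' u w' w x' x by (rule exchange)
  show ?thesis using X.edge_xv True by simp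
qed (rule edge_xv'_of_distinct)

lemma a_vertex: "{s, y} \<in> E \<Longrightarrow> s \<in> S \<Longrightarrow> f s = a \<Longrightarrow> s = u \<or> s = u'"
  unfolding E_eq using fv cdist sides_neq by (auto simp: doubleton_eq_iff)

text \<open>By the adjacencies above, \<open>g\<close> gives \<open>u\<close>, \<open>u'\<close>, \<open>x\<close>, \<open>x'\<close> the same colour. Every other vertex of
  colour \<open>a\<close> can be recoloured to \<open>i\<close> or \<open>j\<close> unless \<open>g\<close> gives it this colour too; after that,
  \<open>x\<close> and \<open>x'\<close> see no vertex of colour \<open>a\<close>.\<close>

lemma impossible: False
proof -
  interpret X: exceptional G k S T E f g a b j i v' v u' u w' w x' x by (rule exchange)
  \<comment> \<open>The triangle \<open>v\<close>, \<open>v'\<close>, \<open>x\<close> uses all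
    three colours of \<open>g\<close>, which determines \<open>g\<close> on the rest of the
    configuration.\<close>
  have base: "g v \<noteq> g v'" "g x \<noteq> g v" "g x \<noteq> g v'"
    using g_edge[OF E_edge[OF in_E(1)]] g_edge[OF edge_xv] g_edge[OF edge_xv'] .
  have third: "g z = g x" if "z \<in> verts G" "g z \<noteq> g v" "g z \<noteq> g v'" for z
    using g_range[OF that(1)] g_range[OF config_verts(1)] g_range[OF config_verts(2)] g_range[OF config_verts(7)] base that(2,3) by auto
  have gx': "g x' = g x" using third[OF config_verts(8)] g_edge[OF X.edge_xv] g_edge[OF X.edge_xv'] by simp
  have gw: "g w = g v"
    using third[OF config_verts(5)] g_edge[OF edge_v'w] g_edge[OF E_edge[OF in_E(4)]] by fastforce
  have gw': "g w' = g v'"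
    using third[OF config_verts(6)] g_edge[OF X.edge_v'w] g_edge[OF E_edge[OF in_E(5)]] gx' by fastforce
  have gu: "g u = g x"
    using third[OF config_verts(3)] g_edge[OF edge_uw'] g_edge[OF E_edge[OF in_E(2)]] gw' by simp
  have gu': "g u' = g x"
    using third[OF config_verts(4)] g_edge[OF X.edge_uw'] g_edge[OF E_edge[OF in_E(3)]] gw by simp
  have free: "{s, y} \<notin> E" if "s \<in> S" "f s = a" "g s \<noteq> g x" for s y
    using a_vertex[of s y] that gu gu' by auto
  \<comment> \<open>These vertices can move to \<open>i\<close>: they have no edges in
    \<open>E\<close>, and the only vertices of colour \<open>i\<close> are \<open>v\<close> and
    \<open>w\<close>, which have the same \<open>g\<close>-colour as \<open>Y\<close>. The set
    \<open>Y'\<close> moves to \<open>j\<close> in the same way.\<close>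
  define Y where "Y = {s \<in> S. f s = a \<and> g s = g v}"
  define Y' where "Y' = {s \<in> S. f s = a \<and> g s = g v'}"
  have freeY: "{s, y} \<notin> E" if "s \<in> Y \<union> Y'" for s y
    using free[of s y] that base by (auto simp: Y_def Y'_def)
  let ?f1 = "\<lambda>z. if z \<in> Y then i else f z"
  have f1: "f \<simeq> ?f1"
  proof (rule match[OF f crange(1,3) cdist(2)])
    show "z \<in> Y" if yz: "y \<in> Y" "{y, z} \<in> edges G" "f z \<in> {a, i}" for y z
    proof -
      have yS: "y \<in> S" using yz(1) by (simp add: Y_def)
      have "f z \<noteq> a" using edge_a[OF yz(2) yS] freeY yz(1) by blast
      then have "z = v \<or> z = w" using only_i in_verts[OF yz(2)] yz(3) by blast
      then have "g z = g y" using gw yz(1) by (auto simp: Y_def)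
      then show ?thesis using g_edge[OF yz(2)] by simp
    qed
    show "i \<noteq> i" if yz: "y \<in> Y" "z \<in> Y" "{y, z} \<in> edges G" for y z
      using edge_a[OF yz(3)] freeY yz(1,2) by (auto simp: Y_def)
  qed (auto simp: Y_def verts)
  let ?f2 = "\<lambda>z. if z \<in> Y' then j else ?f1 z"
  have f2: "?f1 \<simeq> ?f2"
  proof (rule match[OF keq_col[OF f1] crange(1,4) cdist(3)])
    show "z \<in> Y'" if yz: "y \<in> Y'" "{y, z} \<in> edges G" "?f1 z \<in> {a, j}" for y z
    proof -
      have yS: "y \<in> S" using yz(1) by (simp add: Y'_def)
      have "f z \<noteq> a" using edge_a[OF yz(2) yS] freeY yz(1) by blast
      then have "z = v' \<or> z = w'" using only_j in_verts[OF yz(2)] yz(3) cdist by (auto split: if_splits)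
      then have "g z = g y" using gw' yz(1) by (auto simp: Y'_def)
      then show ?thesis using g_edge[OF yz(2)] by simp
    qed
    show "j \<noteq> j" if yz: "y \<in> Y'" "z \<in> Y'" "{y, z} \<in> edges G" for y z
      using edge_a[OF yz(3)] freeY yz(1,2) by (auto simp: Y'_def)
    show "?f1 y \<in> {a, j}" if "y \<in> Y'" for y using that base by (auto simp: Y_def Y'_def)
  qed (auto simp: Y'_def verts)
  define h where "h = ?f2"
  have h: "f \<simeq> h" using keq_trans[OF f1 f2] by (simp add: h_def)
  have hT: "h z = f z" if "z \<in> T" for z using that disj by (auto simp: h_def Y_def Y'_def)
  have hb: "h z \<noteq> b" if "z \<in> S" for z using only_b[OF that] cdist by (simp add: h_def)
  have ha: "g z = g x" if "h z = a" "z \<in> S \<union> T" for z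
  proof -
    have z: "z \<notin> Y" "z \<notin> Y'" "f z = a" using that(1) cdist by (auto simp: h_def split: if_splits)
    then have "z \<in> S" using only_a that(2) by blast
    then show ?thesis using third z that(2) verts by (auto simp: Y_def Y'_def)
  qed
  \<comment> \<open>All vertices that still have colour \<open>a\<close> share the
    \<open>g\<close>-colour of \<open>x\<close>, so none of them is adjacent to \<open>x\<close>,
    nor to \<open>x'\<close> in the next step.\<close>
  have h1: "h \<simeq> h(x := a)"
    by (rule recolor[OF keq_col[OF h] config_verts(7) crange(1)]) (use g_edge ha in_verts in fastforce)
  have h2: "h(x := a) \<simeq> (h(x := a))(x' := a)"
  proof (rule recolor[OF keq_col[OF h1] config_verts(8) crange(1)])
    show "(h(x := a)) z \<noteq> a" if e: "{x', z} \<in> edges G" for z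
      using g_edge[OF e] ha[OF _ in_verts[OF e]] gx' by auto
  qed
  define h' where "h' = (h(x := a))(x' := a)"
  have h': "f \<simeq> h'" using keq_trans[OF keq_trans[OF h h1] h2] by (simp add: h'_def)
  have h'b: "z \<in> T \<and> z \<noteq> x \<and> z \<noteq> x'" if "h' z = b" "z \<in> S \<union> T" for z
    using that hb[of z] cdist by (auto simp: h'_def split: if_splits)
  \<comment> \<open>Once \<open>x\<close> and \<open>x'\<close> have colour \<open>a\<close>,
    neither \<open>w\<close> nor \<open>w'\<close> sees colour \<open>b\<close>, since that colour
    is confined to \<open>T\<close> and their \<open>E\<close>-neighbours there are only
    \<open>x\<close> and \<open>x'\<close>.\<close>
  have h3: "h' \<simeq> h'(w := b)"
  proof (rule recolor[OF keq_col[OF h'] config_verts(5) crange(2)])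
    show "h' z \<noteq> b" if e: "{w, z} \<in> edges G" for z
    proof
      assume "h' z = b"
      then have z: "z \<in> T" "z \<noteq> x" using h'b in_verts[OF e] by auto
      then show False using nbr_w[OF edge_T[OF e inT(1)]] disj by auto
    qed
  qed
  have h4: "h'(w := b) \<simeq> (h'(w := b))(w' := b)"
  proof (rule recolor[OF keq_col[OF h3] config_verts(6) crange(2)])
    show "(h'(w := b)) z \<noteq> b" if e: "{w', z} \<in> edges G" for z
    proof
      assume *: "(h'(w := b)) z = b"
      have "z \<in> T \<and> z \<noteq> x'"
      proof (cases "z = w")
        case True
        then show ?thesis using inT vdist by simp
      next
        case False
        then show ?thesis using * h'b in_verts[OF e] by auto
      qed
      then show False using X.nbr_w[OF edge_T[OF e inT(2)]] disj by auto
    qed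
  qed
  let ?h = "(h'(w := b))(w' := b)"
  have "\<forall>z\<in>T. ?h z \<noteq> i" "\<forall>z\<in>T. ?h z \<noteq> j" "\<forall>z\<in>S. ?h z \<noteq> b"
    using hb by (auto simp: h'_def hT cdist sides_neq only_i_side only_j_side)
  with keq_trans[OF h' keq_trans[OF h3 h4]] show False
    by (rule one_mixed_False[where c = a]) auto
qed

end

section \<open>Reduction to the exceptional case\<close>

context few_edges
begin

lemma card_mixed: "card (mixed f) = k - 2"
proof -
  have "{1..k} = pureS \<union> (pureT \<union> mixed f)"
  proof
    show "{1..k} \<subseteq> pureS \<union> (pureT \<union> mixed f)" using color_cases by blast
    have "pureS \<subseteq> {1..k}" "pureT \<subseteq> {1..k}" by (auto simp: pureS_def pureT_def)
    then show "pureS \<union> (pureT \<union> mixed f) \<subseteq> {1..k}" using mixed_range[OF f] by blast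
  qed
  then have "card {1..k} = card (pureS \<union> (pureT \<union> mixed f))" by simp
  moreover have disjoint: "pureT \<inter> mixed f = {}" by (auto simp: pureT_def mixed_def)
  moreover have "card (pureS \<union> (pureT \<union> mixed f)) = card pureS + card (pureT \<union> mixed f)"
    using pure_disjoint pureS_not_mixed finite_pure finite_mixed by (intro card_Un_disjoint) auto
  moreover have "card (pureT \<union> mixed f) = card pureT + card (mixed f)"
    using disjoint finite_pure finite_mixed by (intro card_Un_disjoint) auto
  ultimately have "card {1..k} = card pureS + card pureT + card (mixed f)" by linarith
  then show ?thesis using card_pure by simp
qed

text \<open>The two edges share their end of colour \<open>i\<close> by \<open>mixed_unique\<close>,
  and then \<open>mixed_matching\<close> identifies the other ends.\<close>

lemma mixed_edge_in_unique:
  assumes "mixed_edge_in S i j" "mixed_edge_in S i l" "i \<in> mixed f" "j \<in> mixed f" "l \<in> mixed f"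
  shows "j = l"
proof -
  obtain u v where uv: "{u, v} \<in> E" "u \<in> S" "f u = i" "f v = j"
    using assms(1) by (auto simp: mixed_edge_in_def)
  obtain u' v' where uv': "{u', v'} \<in> E" "u' \<in> S" "f u' = i" "f v' = l"
    using assms(2) by (auto simp: mixed_edge_in_def)
  have "u = u'" using mixed_unique uv uv' assms(3) by simp
  then have "v = v'" using mixed_matching[of u v v'] uv uv' assms(3-5) by simp
  then show ?thesis using uv(4) uv'(4) by simp
qed

lemma mixed_edge_in_sym:
  assumes "mixed_edge_in S i j"
  shows "mixed_edge_in S j i"
proof -
  obtain u v where uv: "{u, v} \<in> E" "u \<in> S" "f u = i" "f v = j"
    using assms unfolding mixed_edge_in_def by blast
  then show ?thesis using E_S[OF uv(1,2)] E_sym[OF uv(1)] unfolding mixed_edge_in_def by blast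
qed

lemma mixed_edge_in_S_or_T:
  assumes "i \<in> mixed f" "j \<in> mixed f" "i \<noteq> j"
  shows "mixed_edge_in S i j \<or> mixed_edge_in T i j"
proof -
  have "i \<in> {1..k}" "j \<in> {1..k}" using assms mixed_range[OF f] by auto
  then obtain u v where uv: "{u, v} \<in> E" "f u = i" "f v = j"
    using least_mixed_edge[OF least _ _ assms(3)] assms(1) by blast
  then have "u \<in> S \<or> u \<in> T" using E_verts by blast
  then show ?thesis using uv unfolding mixed_edge_in_def by blast
qed

text \<open>Each pair among three mixed colours is joined by an edge on some side. Two of the three
  pairs use the same side and share a colour, which \<open>mixed_edge_in_unique\<close>
  forbids.\<close>

lemma card_mixed_le: "card (mixed f) \<le> 2"
proof (rule ccontr)
  interpret M: few_edges G k T S E f by (rule few_mirror)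
  assume "\<not> card (mixed f) \<le> 2"
  then obtain A where "A \<subseteq> mixed f" "card A = 3"
    by (metis not_less_eq_eq numeral_2_eq_2 numeral_3_eq_3 obtain_subset_with_card_n)
  then obtain i j l where m: "i \<in> mixed f" "j \<in> mixed f" "l \<in> mixed f" and ne: "i \<noteq> j" "i \<noteq> l" "j \<noteq> l"
    by (auto simp: card_3_iff)
  have M: "M.mixed = mixed" by (rule mixed_mirror)
  have S: "\<not> (mixed_edge_in S p q \<and> mixed_edge_in S p r)"
    if "p \<in> mixed f" "q \<in> mixed f" "r \<in> mixed f" "q \<noteq> r" for p q r
    using mixed_edge_in_unique[of p q r] that by blast
  have T: "\<not> (mixed_edge_in T p q \<and> mixed_edge_in T p r)"
    if "p \<in> mixed f" "q \<in> mixed f" "r \<in> mixed f" "q \<noteq> r" for p q r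
    using M.mixed_edge_in_unique[of p q r] that M by auto
  note sym = mixed_edge_in_sym M.mixed_edge_in_sym
  show False
    using mixed_edge_in_S_or_T[OF m(1,2) ne(1)] mixed_edge_in_S_or_T[OF m(1,3) ne(2)]
      mixed_edge_in_S_or_T[OF m(2,3) ne(3)] S[OF m(1,2,3) ne(3)] T[OF m(1,2,3) ne(3)]
      S[OF m(2,1,3) ne(2)] T[OF m(2,1,3) ne(2)] S[OF m(3,1,2) ne(1)] T[OF m(3,1,2) ne(1)] sym
    by metis
qed

text \<open>The edge \<open>v v'\<close> comes from the hypothesis and the other four from
  \<open>sees_pure\<close> on both sides; since each colour pair has at most one edge, they exhaust
  \<open>E\<close>.\<close>

lemma no_mixed_edge_in:
  assumes k: "k = 4" and g: "g \<in> colorings G 3" and e: "mixed_edge_in S i j" and ij: "mixed f = {i, j}" "i \<noteq> j"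
  shows False
proof -
  interpret M: few_edges G k T S E f by (rule few_mirror)
  have MM: "M.mixed = mixed" by (rule mixed_mirror)
  have MS: "M.pureS = pureT" by (simp add: M.pureS_def pureT_def)
  obtain a where a: "pureS = {a}" using card_pure(1) by (metis card_1_singletonE)
  obtain b where b: "pureT = {b}" using card_pure(2) by (metis card_1_singletonE)
  have im: "i \<in> mixed f" "j \<in> mixed f" using ij by auto
  obtain v v' where v: "{v, v'} \<in> E" "v \<in> S" "f v = i" "f v' = j"
    using e by (auto simp: mixed_edge_in_def)
  have v'S: "v' \<in> S" using E_S v by blast
  obtain u where u: "{v, u} \<in> E" "f u = a" using sees_pure[of v a] v im a by auto
  obtain u' where u': "{v', u'} \<in> E" "f u' = a" using sees_pure[of v' a] v v'S im a by auto
  obtain w where w: "w \<in> T" "f w = i" using im(1) by (auto simp: mixed_def)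
  obtain w' where w': "w' \<in> T" "f w' = j" using im(2) by (auto simp: mixed_def)
  obtain x where x: "{w, x} \<in> E" "f x = b" using M.sees_pure[of w b] w im b MM MS by auto
  obtain x' where x': "{w', x'} \<in> E" "f x' = b" using M.sees_pure[of w' b] w' im b MM MS by auto
  have colors: "{1..k} = {a, b, i, j}"
  proof
    show "{1..k} \<subseteq> {a, b, i, j}" using color_cases a b ij(1) by blast
    have "a \<in> {1..k}" "b \<in> {1..k}" using a b by (auto simp: pureS_def pureT_def)
    then show "{a, b, i, j} \<subseteq> {1..k}" using im mixed_range[OF f] by blast
  qed
  have ab: "a \<noteq> b" using a b pure_disjoint by auto
  have am: "a \<notin> mixed f" using a pureS_not_mixed by blast
  have bm: "b \<notin> mixed f" using b M.pureS_not_mixed MM MS by auto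
  have distinct: "distinct [a, b, i, j]" using ab am bm ij by auto
  have "exceptional G k S T E f g a b i j v v' u u' w w' x x'"
  proof
    show "f \<in> colorings G k" "g \<in> colorings G 3" by (rule f g)+
    show "{1..k} = {a, b, i, j}" "distinct [a, b, i, j]" by (rule colors distinct)+
    show "v \<in> S" "v' \<in> S" "u \<in> S" "u' \<in> S" using v v'S E_S u u' by blast+
    show "w \<in> T" "w' \<in> T" "x \<in> T" "x' \<in> T" using w w' M.E_S x x' by blast+
    show "f v = i" "f v' = j" "f u = a" "f u' = a" "f w = i" "f w' = j" "f x = b" "f x' = b"
      using v u u' w w' x x' by auto
    show "z = v \<or> z = w" if "f z = i" "z \<in> S \<union> T" for z
      using mixed_unique[of z v] M.mixed_unique[of z w] that v w im MM by auto
    show "z = v' \<or> z = w'" if "f z = j" "z \<in> S \<union> T" for z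
      using mixed_unique[of z v'] M.mixed_unique[of z w'] that v v'S w' im MM by auto
    have "a \<in> pureS" "b \<in> pureT" using a b by auto
    then show "z \<in> T \<Longrightarrow> f z \<noteq> a" "z \<in> S \<Longrightarrow> f z \<noteq> b" for z
      by (auto simp: pureS_def pureT_def)
    show "u \<noteq> u'"
    proof
      assume "u = u'"
      then show False using no_triangle[OF v(1) u'(1)] u(1) by simp
    qed
    show "2 \<le> card (mixed f')" if "f \<simeq> f'" for f'
    proof -
      have "card (mixed f) \<le> card (mixed f')" using least that unfolding least_mixed_def by blast
      then show ?thesis unfolding card_mixed using k by simp
    qed
    show "E = {{v, v'}, {u, v}, {u', v'}, {x, w}, {x', w'}}"
    proof
      show "{{v, v'}, {u, v}, {u', v'}, {x, w}, {x', w'}} \<subseteq> E"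
        using v(1) E_sym u(1) u'(1) x(1) x'(1) by blast
      show "E \<subseteq> {{v, v'}, {u, v}, {u', v'}, {x, w}, {x', w'}}"
      proof
        fix e assume e: "e \<in> E"
        obtain p q where pq: "e = {p, q}" using E_doubleton[OF e] by blast
        have pqE: "{p, q} \<in> E" using e pq by simp
        have ne: "f p \<noteq> f q" using col_proper[OF f E_edge[OF pqE]] .
        have "f p \<in> {1..k}" "f q \<in> {1..k}"
          using col_range[OF f] edge_verts[OF E_edge[OF pqE]] by auto
        then have r: "f p \<in> {a, b, i, j}" "f q \<in> {a, b, i, j}" unfolding colors .
        \<comment> \<open>Of the six colour pairs only the crossing one is excluded. The other five
          are realised by the listed edges, so \<open>unique_edges\<close> identifies
          \<open>e\<close> with one of them.\<close>
        have "{f p, f q} \<noteq> {a, b}"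
          using edge_not_crossing[OF pqE] edge_not_crossing[OF E_sym[OF pqE]] a b
          by (auto simp: doubleton_eq_iff)
        then have "{f p, f q} \<in> {{i, j}, {a, i}, {a, j}, {b, i}, {b, j}}"
          using r ne by (elim insertE emptyE) (simp_all add: insert_commute)
        moreover have "f ` e = {f p, f q}" using pq by simp
        ultimately have im: "f ` e \<in> {{i, j}, {a, i}, {a, j}, {b, i}, {b, j}}" by simp
        have imgs: "f ` {v, v'} = {i, j}" "f ` {u, v} = {a, i}" "f ` {u', v'} = {a, j}"
          "f ` {x, w} = {b, i}" "f ` {x', w'} = {b, j}"
          using v u u' w w' x x' by simp_all
        have inE: "{v, v'} \<in> E" "{u, v} \<in> E" "{u', v'} \<in> E" "{x, w} \<in> E" "{x', w'} \<in> E"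
          using v(1) E_sym u(1) u'(1) x(1) x'(1) by blast+
        note un = unique_edges[OF e]
        from im show "e \<in> {{v, v'}, {u, v}, {u', v'}, {x, w}, {x', w'}}"
          using un[OF inE(1)] un[OF inE(2)] un[OF inE(3)] un[OF inE(4)] un[OF inE(5)] imgs
          by (elim insertE emptyE) simp_all
      qed
    qed
  qed
  then show False by (rule exceptional.impossible)
qed

lemma contradiction:
  assumes "k \<ge> 4" "colorable G (k - 1)"
  shows False
proof -
  interpret M: few_edges G k T S E f by (rule few_mirror)
  have k: "k = 4" using card_mixed card_mixed_le assms(1) by simp
  then obtain g where g: "g \<in> colorings G 3" using assms(2) by (auto simp: colorable_def)
  have "card (mixed f) = 2" using card_mixed k by simp
  then obtain i j where ij: "mixed f = {i, j}" "i \<noteq> j" by (auto simp: card_2_iff)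
  have "M.mixed f = {i, j}" using ij(1) mixed_mirror by simp
  then show False
    using mixed_edge_in_S_or_T[of i j] ij no_mixed_edge_in[OF k g _ ij] M.no_mixed_edge_in[OF k g _ _ ij(2)]
    by blast
qed

end

section \<open>Reaching a colouring without mixed colours\<close>

context almost_bipartite
begin

text \<open>Minimises the two counts lexicographically over the Kempe class; a remaining mixed
  colour would make the minimum an instance of \<open>few_edges\<close>.\<close>

lemma ex_split:
  assumes k: "k \<ge> 4" "colorable G (k - 1)" and few: "card E < k choose 2" and f0: "f0 \<in> colorings G k"
  obtains f where "f0 \<simeq> f" "mixed f = {}"
proof -
  obtain f1 where f1: "f0 \<simeq> f1" "\<And>f'. f0 \<simeq> f' \<Longrightarrow> card (mixed f1) \<le> card (mixed f')"
    using ex_has_least_nat[of "\<lambda>f. f0 \<simeq> f" f0 "\<lambda>f. card (mixed f)"] keq_refl[OF f0] by blast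
  let ?m = "\<lambda>f. card {v \<in> S \<union> T. f v \<in> mixed f}"
  have "\<exists>f2. (f0 \<simeq> f2 \<and> card (mixed f2) = card (mixed f1)) \<and>
      (\<forall>f'. f0 \<simeq> f' \<and> card (mixed f') = card (mixed f1) \<longrightarrow> ?m f2 \<le> ?m f')"
    by (rule ex_has_least_nat[of "\<lambda>f. f0 \<simeq> f \<and> card (mixed f) = card (mixed f1)" f1 ?m]) (use f1(1) in simp)
  then obtain f2 where f2: "f0 \<simeq> f2" "card (mixed f2) = card (mixed f1)"
    "\<And>f'. f0 \<simeq> f' \<Longrightarrow> card (mixed f') = card (mixed f1) \<Longrightarrow> ?m f2 \<le> ?m f'" by blast
  have "mixed f2 = {}"
  proof (rule ccontr)
    assume ne: "mixed f2 \<noteq> {}"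
    have "few_edges G k S T E f2"
    proof
      show "least_mixed f2"
        unfolding least_mixed_def
      proof (intro conjI allI impI)
        show "card (mixed f2) \<le> card (mixed f')" if "f2 \<simeq> f'" for f'
          using f1(2)[OF keq_trans[OF f2(1) that]] f2(2) by simp
      qed (use ne keq_col[OF f2(1)] in auto)
      show "?m f2 \<le> ?m f'" if "f2 \<simeq> f'" "mixed f' = mixed f2" for f'
        using f2(3)[OF keq_trans[OF f2(1) that(1)]] f2(2) that(2) by simp
    qed (rule few)
    then show False using few_edges.contradiction k by blast
  qed
  then show ?thesis using that f2(1) by blast
qed

subsection \<open>Colourings without mixed colours\<close>

definition odd_cycles :: "'a set set" where
  "odd_cycles = {C \<in> components (edge_graph E). \<exists>h n. cyc h n \<and> odd n \<and> range h = C}"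

text \<open>The choice depends on the cycles alone and not on a colouring, so two colourings are
  normalised with respect to the same roots.\<close>

definition roots :: "'a set" where
  "roots = (\<lambda>C. SOME v. v \<in> C) ` odd_cycles"

lemma root_in:
  assumes "C \<in> odd_cycles"
  shows "\<exists>r\<in>roots. r \<in> C"
proof -
  have "C \<noteq> {}" using assms by (auto simp: odd_cycles_def)
  then have "(SOME v. v \<in> C) \<in> C" by (simp add: some_in_eq)
  then show ?thesis using assms by (auto simp: roots_def)
qed

lemma root_cycle:
  assumes "r \<in> roots"
  obtains C where "C \<in> odd_cycles" "r \<in> C" "\<And>r'. r' \<in> roots \<Longrightarrow> r' \<in> C \<Longrightarrow> r' = r"
proof -
  have some: "(SOME v. v \<in> C) \<in> C" if "C \<in> odd_cycles" for C
  proof -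
    have "C \<noteq> {}" using that by (auto simp: odd_cycles_def)
    then show ?thesis by (simp add: some_in_eq)
  qed
  obtain C where C: "C \<in> odd_cycles" "r = (SOME v. v \<in> C)" using assms by (auto simp: roots_def)
  have "r' = r" if r': "r' \<in> roots" "r' \<in> C" for r'
  proof -
    obtain C' where C': "C' \<in> odd_cycles" "r' = (SOME v. v \<in> C')" using r' by (auto simp: roots_def)
    have "r' \<in> C'" using some[OF C'(1)] C'(2) by simp
    then have "C' = C"
      using component_eq[of C' "edge_graph E" r'] component_eq[of C "edge_graph E" r'] r'(2) C(1) C'(1)
      by (simp add: odd_cycles_def)
    then show ?thesis using C C' by simp
  qed
  then show ?thesis using that[OF C(1)] some[OF C(1)] C(2) by blast
qed

lemma cyc_in_S:
  assumes "cyc h n" "h x \<in> S"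
  shows "range h \<subseteq> S"
proof -
  have E: "{h y, h (Suc y)} \<in> E" for y using assms(1) by (simp add: cyc_def)
  have h0: "h 0 \<in> S"
    using assms(2) by (induction x) (use E E_S E_sym in blast)+
  have "h y \<in> S" for y
    using h0 by (induction y) (use E E_S in blast)+
  then show ?thesis by blast
qed

text \<open>Two colours would alternate along \<open>h\<close>, while \<open>h n = h 0\<close> with
  \<open>n\<close> odd.\<close>

lemma odd_cycle_third_color:
  assumes "f \<in> colorings G k" "cyc h n" "odd n"
  shows "\<exists>x. f (h x) \<notin> {a, b}"
proof (rule ccontr)
  assume "\<not> ?thesis"
  then have ab: "f (h x) \<in> {a, b}" for x by blast
  have E: "f (h x) \<noteq> f (h (Suc x))" for x
  proof -
    have "{h x, h (Suc x)} \<in> E" using assms(2) by (simp add: cyc_def)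
    then show ?thesis using col_proper[OF assms(1) E_edge] by blast
  qed
  have "f (h x) = f (h 0) \<longleftrightarrow> even x" for x
  proof (induction x)
    case (Suc x)
    have two: "q = r \<longleftrightarrow> p \<noteq> r" if "p \<in> {a, b}" "q \<in> {a, b}" "r \<in> {a, b}" "p \<noteq> q" for p q r :: nat
      using that by blast
    show ?case using two[OF ab ab ab E] Suc.IH by simp
  qed simp
  moreover have "h n = h 0" using cyc_eq[OF assms(2), of n 0] by simp
  ultimately show False using assms(3) by metis
qed

text \<open>The vertices are absorbed one at a time. The odd cycle outcome of \<open>absorb\<close>
  cannot occur: the cycle contains a root, which differs from \<open>v\<close> and has colour
  \<open>c\<close> outside \<open>{a, b}\<close>.\<close>

lemma to_two_colors:
  assumes "f \<in> colorings G k" and ab: "a \<in> {1..k}" "b \<in> {1..k}" "a \<noteq> b" "c \<notin> {a, b}"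
    and "\<And>t. t \<in> T \<Longrightarrow> f t \<notin> {a, b}" and "\<And>r. r \<in> roots \<Longrightarrow> r \<in> S \<Longrightarrow> f r = c"
  shows "\<exists>f'. f \<simeq> f' \<and> (\<forall>v\<in>S - roots. f' v \<in> {a, b}) \<and> (\<forall>r\<in>roots \<inter> S. f' r = c) \<and>
    (\<forall>t\<in>T. f' t = f t)"
  using assms(1,6,7)
proof (induction "card {v \<in> S - roots. f v \<notin> {a, b}}" arbitrary: f rule: less_induct)
  case less
  show ?case
  proof (cases "\<forall>v\<in>S - roots. f v \<in> {a, b}")
    case True
    then show ?thesis using keq_refl[OF less.prems(1)] less.prems(3) by blast
  next
    case False
    then obtain v where v: "v \<in> S" "v \<notin> roots" "f v \<notin> {a, b}" by blast
    show ?thesis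
    proof (rule absorb[OF less.prems(1) ab(1-3) _ v(1,3)])
      show "f t \<notin> {a, b}" if "t \<in> T" for t using less.prems(2) that .
    next
      fix f' assume f': "f \<simeq> f'" "absorbed a b v f f'"
      have keep: "f' u = f u" if "u \<noteq> v" "f u \<notin> {a, b}" for u
        using f'(2) that unfolding absorbed_def by blast
      have T: "f' t = f t" if "t \<in> T" for t
        using keep[of t] less.prems(2)[OF that] v(1) that disj by blast
      have R: "f' r = c" if "r \<in> roots" "r \<in> S" for r
        using keep[of r] less.prems(3)[OF that] that v(2) ab(4) by auto
      have "f u \<notin> {a, b} \<and> u \<noteq> v" if "f' u \<notin> {a, b}" for u
        using f'(2) that unfolding absorbed_def by blast
      then have "{v \<in> S - roots. f' v \<notin> {a, b}} \<subset> {v \<in> S - roots. f v \<notin> {a, b}}"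
        using v by blast
      then have "card {v \<in> S - roots. f' v \<notin> {a, b}} < card {v \<in> S - roots. f v \<notin> {a, b}}"
        using finite_parts by (intro psubset_card_mono) auto
      then have "\<exists>f''. f' \<simeq> f'' \<and> (\<forall>v\<in>S - roots. f'' v \<in> {a, b}) \<and>
          (\<forall>r\<in>roots \<inter> S. f'' r = c) \<and> (\<forall>t\<in>T. f'' t = f' t)"
      proof (rule less.hyps[OF _ keq_col[OF f'(1)]])
        show "f' t \<notin> {a, b}" if "t \<in> T" for t using T[OF that] less.prems(2)[OF that] by simp
      qed (rule R)
      then obtain f'' where f'': "f' \<simeq> f''" "\<forall>v\<in>S - roots. f'' v \<in> {a, b}"
          "\<forall>r\<in>roots \<inter> S. f'' r = c" "\<forall>t\<in>T. f'' t = f' t" by blast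
      then show ?thesis using keq_trans[OF f'(1) f''(1)] T by auto
    next
      fix h n
      assume h: "cyc h n" "odd n" "h 0 = v" "range h \<in> components (edge_graph E)"
        "\<And>x. 0 < x \<Longrightarrow> x < n \<Longrightarrow> f (h x) \<in> {a, b}"
      have "range h \<in> odd_cycles" using h by (auto simp: odd_cycles_def)
      then obtain r where r: "r \<in> roots" "r \<in> range h" using root_in by blast
      then obtain y where y: "r = h y" by blast
      let ?x = "y mod n"
      have x: "r = h ?x" "?x < n" using y cyc_mod[OF h(1), of y] h(1) by (auto simp: cyc_def)
      have "r \<in> S" using cyc_in_S[OF h(1), of 0] h(3) v(1) r(2) by auto
      then have "f r = c" using less.prems(3) r(1) by blast
      moreover have "?x \<noteq> 0"
      proof
        assume "?x = 0"
        then have "r = v" using x(1) h(3) by simp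
        then show False using r(1) v(2) by simp
      qed
      ultimately show ?thesis using h(5)[of ?x] x ab(4) by auto
    qed
  qed
qed

text \<open>Neither \<open>f r\<close> nor \<open>c\<close> occurs on \<open>T\<close>, so swapping
  these colours on the whole cycle of \<open>r\<close> is closed. Other roots lie on other cycles
  and are unaffected.\<close>

lemma color_roots:
  assumes "f \<in> colorings G k" "mixed f = {}" and c: "c \<in> {1..k}" "c \<notin> f ` T"
  shows "\<exists>f'. f \<simeq> f' \<and> (\<forall>r\<in>roots \<inter> S. f' r = c) \<and> (\<forall>t\<in>T. f' t = f t)"
  using assms
proof (induction "card {r \<in> roots \<inter> S. f r \<noteq> c}" arbitrary: f rule: less_induct)
  case less
  show ?case
  proof (cases "\<forall>r\<in>roots \<inter> S. f r = c")
    case True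
    then show ?thesis using keq_refl[OF less.prems(1)] by blast
  next
    case False
    then obtain r where r: "r \<in> roots" "r \<in> S" "f r \<noteq> c" by blast
    obtain C where C: "C \<in> odd_cycles" "r \<in> C" "\<And>r'. r' \<in> roots \<Longrightarrow> r' \<in> C \<Longrightarrow> r' = r"
      using root_cycle[OF r(1)] by blast
    have CC: "C \<in> components (edge_graph E)" using C(1) by (simp add: odd_cycles_def)
    obtain h n where h: "cyc h n" "range h = C" using C(1) by (auto simp: odd_cycles_def)
    have CS: "C \<subseteq> S"
    proof -
      obtain x where "r = h x" using C(2) h(2) by blast
      then show ?thesis using cyc_in_S[OF h(1)] h(2) r(2) by blast
    qed
    have fr: "f r \<in> {1..k}" "f r \<notin> f ` T"
      using col_range[OF less.prems(1)] r(2) verts less.prems(2) by (auto simp: mixed_def)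
    define D where "D = {v \<in> C. f v \<in> {f r, c}}"
    let ?f = "\<lambda>v. if v \<in> D then transpose (f r) c (f v) else f v"
    have f1: "f \<simeq> ?f"
    proof (rule swap_closed[OF less.prems(1) fr(1) less.prems(3) r(3)])
      show "z \<in> D" if yz: "y \<in> D" "{y, z} \<in> edges G" "f z \<in> {f r, c}" for y z
      proof -
        have "z \<notin> T"
        proof
          assume "z \<in> T"
          then have "f z \<in> f ` T" by (rule imageI)
          then show False using yz(3) fr(2) less.prems(4) by (metis insertE singletonD)
        qed
        moreover have "y \<in> C" using yz(1) by (simp add: D_def)
        ultimately have "{y, z} \<in> E" using edge_S[OF yz(2)] CS by blast
        then have "(y, z) \<in> adj (edge_graph E)" by (auto simp: adj_def edge_graph_def)
        then have "z \<in> C" using components_closed[OF CC \<open>y \<in> C\<close>] by blast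
        then show ?thesis using yz(3) by (simp add: D_def)
      qed
    qed (use CS verts in \<open>auto simp: D_def\<close>)
    have T: "?f t = f t" if "t \<in> T" for t using that CS disj by (auto simp: D_def)
    have rc: "?f r = c" using C(2) by (simp add: D_def)
    have R: "?f r' = f r'" if "r' \<in> roots" "r' \<noteq> r" for r'
      using C(3)[OF that(1)] that(2) by (auto simp: D_def)
    have TT: "?f ` T = f ` T" using T by auto
    have "mixed ?f = {}"
    proof -
      have "?f s \<notin> f ` T" if "s \<in> S" for s
      proof (cases "s \<in> D")
        case True
        then have "?f s = f r \<or> ?f s = c" by (auto simp: D_def transpose_def)
        then show ?thesis
          by (rule disjE) (simp_all only: fr(2) less.prems(4) not_False_eq_True)
      next
        case False
        then show ?thesis using that less.prems(2) by (auto simp: mixed_def)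
      qed
      then show ?thesis unfolding mixed_def TT by blast
    qed
    moreover have "card {r \<in> roots \<inter> S. ?f r \<noteq> c} < card {r \<in> roots \<inter> S. f r \<noteq> c}"
    proof (rule psubset_card_mono)
      show "finite {r \<in> roots \<inter> S. f r \<noteq> c}" using finite_parts by simp
      have "f s \<noteq> c \<and> s \<noteq> r" if "s \<in> roots" "?f s \<noteq> c" for s
        using R[OF that(1)] rc that(2) by metis
      then have "{r \<in> roots \<inter> S. ?f r \<noteq> c} \<subseteq> {r \<in> roots \<inter> S. f r \<noteq> c} - {r}" by blast
      then show "{r \<in> roots \<inter> S. ?f r \<noteq> c} \<subset> {r \<in> roots \<inter> S. f r \<noteq> c}" using r by blast
    qed
    moreover have "c \<notin> ?f ` T" using TT less.prems(4) by simp
    ultimately have "\<exists>f'. ?f \<simeq> f' \<and> (\<forall>r\<in>roots \<inter> S. f' r = c) \<and> (\<forall>t\<in>T. f' t = ?f t)"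
      by (intro less.hyps[OF _ keq_col[OF f1] _ less.prems(3)])
    then obtain f' where f': "?f \<simeq> f'" "\<forall>r\<in>roots \<inter> S. f' r = c" "\<forall>t\<in>T. f' t = ?f t"
      by blast
    then show ?thesis using keq_trans[OF f1 f'(1)] T by auto
  qed
qed

text \<open>The ends of the given edge provide two colours that avoid \<open>T\<close>; if there is
  a root in \<open>S\<close>, its odd cycle provides a third one for the roots.\<close>

lemma normalize_S:
  assumes f: "f \<in> colorings G k" "mixed f = {}" and k: "3 \<le> k" and e: "{u, v} \<in> E" "u \<in> S"
  obtains f' a b c where "f \<simeq> f'" "a \<in> {1..k}" "b \<in> {1..k}" "a \<noteq> b" "c \<notin> {a, b}" "a \<notin> f ` T" "b \<notin> f ` T"
    "roots \<inter> S \<noteq> {} \<Longrightarrow> c \<notin> f ` T" "\<And>v. v \<in> S \<Longrightarrow> v \<notin> roots \<Longrightarrow> f' v \<in> {a, b}"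
    "\<And>r. r \<in> roots \<Longrightarrow> r \<in> S \<Longrightarrow> f' r = c" "\<And>t. t \<in> T \<Longrightarrow> f' t = f t"
proof -
  let ?a = "f u" and ?b = "f v"
  have vS: "v \<in> S" using E_S[OF e] .
  have S_range: "f s \<in> {1..k}" "f s \<notin> f ` T" if "s \<in> S" for s
    using col_range[OF f(1)] that verts f(2) by (auto simp: mixed_def)
  have ne: "?a \<noteq> ?b" using col_proper[OF f(1) E_edge[OF e(1)]] .
  have ex: "\<exists>c f1. c \<notin> {?a, ?b} \<and> (roots \<inter> S \<noteq> {} \<longrightarrow> c \<notin> f ` T) \<and> f \<simeq> f1 \<and>
    (\<forall>r\<in>roots \<inter> S. f1 r = c) \<and> (\<forall>t\<in>T. f1 t = f t)"
  proof (cases "roots \<inter> S = {}")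
    case True
    \<comment> \<open>No vertex of \<open>S\<close> has to receive \<open>c\<close> here, so any
      value outside the two colours will do.\<close>
    have "\<not> {1..k} \<subseteq> {?a, ?b}"
    proof
      assume "{1..k} \<subseteq> {?a, ?b}"
      then have "card {1..k} \<le> card {?a, ?b}" by (intro card_mono) auto
      moreover have "card {?a, ?b} \<le> 2" by (simp add: card_insert_if)
      ultimately show False using k by simp
    qed
    then obtain c where "c \<notin> {?a, ?b}" by blast
    then show ?thesis using True keq_refl[OF f(1)] by blast
  next
    case False
    then obtain r where r: "r \<in> roots" "r \<in> S" by blast
    obtain C where C: "C \<in> odd_cycles" "r \<in> C" using root_cycle[OF r(1)] by blast
    obtain h n where h: "cyc h n" "odd n" "range h = C" using C(1) by (auto simp: odd_cycles_def)
    obtain y where "r = h y" using C(2) h(3) by blast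
    then have CS: "range h \<subseteq> S" using cyc_in_S[OF h(1)] r(2) by blast
    obtain x where x: "f (h x) \<notin> {?a, ?b}" using odd_cycle_third_color[OF f(1) h(1,2)] by blast
    have "h x \<in> S" using CS by blast
    then have c: "f (h x) \<in> {1..k}" "f (h x) \<notin> f ` T" using S_range by auto
    then show ?thesis using color_roots[OF f c] x by blast
  qed
  then obtain c f1 where f1: "c \<notin> {?a, ?b}" "roots \<inter> S \<noteq> {} \<longrightarrow> c \<notin> f ` T" "f \<simeq> f1"
    "\<forall>r\<in>roots \<inter> S. f1 r = c" "\<forall>t\<in>T. f1 t = f t" by blast
  have "\<exists>f'. f1 \<simeq> f' \<and> (\<forall>v\<in>S - roots. f' v \<in> {?a, ?b}) \<and> (\<forall>r\<in>roots \<inter> S. f' r = c) \<and>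
    (\<forall>t\<in>T. f' t = f1 t)"
  proof (rule to_two_colors[OF keq_col[OF f1(3)] S_range(1)[OF e(2)] S_range(1)[OF vS] ne f1(1)])
    show "f1 t \<notin> {?a, ?b}" if "t \<in> T" for t
    proof -
      have "f1 t \<in> f ` T" using f1(5) that by simp
      then show ?thesis using S_range(2)[OF e(2)] S_range(2)[OF vS] by auto
    qed
  qed (use f1(4) in blast)
  then obtain f' where f': "f1 \<simeq> f'" "\<forall>v\<in>S - roots. f' v \<in> {?a, ?b}" "\<forall>r\<in>roots \<inter> S. f' r = c"
    "\<forall>t\<in>T. f' t = f1 t" by blast
  show ?thesis
  proof (rule that[of f' ?a ?b c])
    show "f \<simeq> f'" using keq_trans[OF f1(3) f'(1)] .
    show "roots \<inter> S \<noteq> {} \<Longrightarrow> c \<notin> f ` T" using f1(2) by blast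
  qed (use S_range e vS ne f1 f' in simp_all)
qed

text \<open>Here \<open>S\<close> is independent and the colour \<open>f s\<close> is absent from
  \<open>T\<close>, so each vertex of \<open>S\<close> can take it in turn.\<close>

lemma monochromatic_S:
  assumes "f \<in> colorings G k" "mixed f = {}" and s: "s \<in> S" and none: "\<And>u v. u \<in> S \<Longrightarrow> {u, v} \<notin> E"
  shows "\<exists>f'. f \<simeq> f' \<and> (\<forall>v\<in>S. f' v = f s) \<and> (\<forall>t\<in>T. f' t = f t)"
proof -
  define a where "a = f s"
  have a: "a \<in> {1..k}" "a \<notin> f ` T"
    using col_range[OF assms(1)] s verts assms(2) by (auto simp: mixed_def a_def)
  have "\<exists>f'. f \<simeq> f' \<and> (\<forall>v\<in>S. f' v = a) \<and> (\<forall>t\<in>T. f' t = f t)"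
    using assms(1) a
  proof (induction "card {v \<in> S. f v \<noteq> a}" arbitrary: f rule: less_induct)
    case less
    show ?case
    proof (cases "\<forall>v\<in>S. f v = a")
      case True
      then show ?thesis using keq_refl[OF less.prems(1)] by blast
    next
      case False
      then obtain v where v: "v \<in> S" "f v \<noteq> a" by blast
      have f1: "f \<simeq> f(v := a)"
      proof (rule recolor[OF less.prems(1) _ less.prems(2)])
        show "f z \<noteq> a" if "{v, z} \<in> edges G" for z
          using edge_S[OF that v(1)] none[OF v(1), of z] less.prems(3) by blast
      qed (use v verts in auto)
      have vT: "v \<notin> T" using v(1) disj by blast
      have "{w \<in> S. (f(v := a)) w \<noteq> a} \<subset> {w \<in> S. f w \<noteq> a}" using v by auto
      then have "card {w \<in> S. (f(v := a)) w \<noteq> a} < card {w \<in> S. f w \<noteq> a}"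
        using finite_parts by (intro psubset_card_mono) auto
      moreover have "a \<notin> (f(v := a)) ` T" using vT less.prems(3) by auto
      ultimately have "\<exists>f'. f(v := a) \<simeq> f' \<and> (\<forall>v\<in>S. f' v = a) \<and> (\<forall>t\<in>T. f' t = (f(v := a)) t)"
        by (intro less.hyps[OF _ keq_col[OF f1] less.prems(2)])
      then obtain f' where f': "f(v := a) \<simeq> f'" "\<forall>v\<in>S. f' v = a" "\<forall>t\<in>T. f' t = (f(v := a)) t"
        by blast
      moreover have "(f(v := a)) t = f t" if "t \<in> T" for t using that vT by auto
      ultimately show ?thesis using keq_trans[OF f1 f'(1)] by metis
    qed
  qed
  then show ?thesis by (simp add: a_def)
qed

text \<open>After normalisation both colourings are constant on the roots and use two colours on the
  rest of \<open>S\<close>. These 2-colourings may still differ from component to component, which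
  \<open>match\<close> repairs.\<close>

lemma align_S:
  assumes f: "f \<in> colorings G k" "mixed f = {}" and g: "g \<in> colorings G k" "mixed g = {}" and k: "3 \<le> k"
  shows "\<exists>f' g'. f \<simeq> f' \<and> g \<simeq> g' \<and> mixed f' = {} \<and> mixed g' = {} \<and>
    (\<forall>t\<in>T. f' t = f t \<and> g' t = g t) \<and> (\<forall>s\<in>S. \<forall>s'\<in>S. f' s = f' s' \<longleftrightarrow> g' s = g' s')"
proof (cases "\<exists>u v. {u, v} \<in> E \<and> u \<in> S")
  case False
  show ?thesis
  proof (cases "S = {}")
    case True
    then show ?thesis using f g keq_refl by blast
  next
    case ne: False
    then obtain s where s: "s \<in> S" by blast
    have none: "{u, v} \<notin> E" if "u \<in> S" for u v using False that by blast
    obtain f' where f': "f \<simeq> f'" "\<forall>v\<in>S. f' v = f s" "\<forall>t\<in>T. f' t = f t"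
      using monochromatic_S[OF f s none] by blast
    obtain g' where g': "g \<simeq> g'" "\<forall>v\<in>S. g' v = g s" "\<forall>t\<in>T. g' t = g t"
      using monochromatic_S[OF g s none] by blast
    have "mixed f' = {}" "mixed g' = {}"
      using f(2) g(2) f'(2,3) g'(2,3) s by (auto simp: mixed_def)
    then show ?thesis using f' g' by (intro exI[of _ f'] exI[of _ g']) simp
  qed
next
  case True
  then obtain u v where uv: "{u, v} \<in> E" "u \<in> S" by blast
  obtain f' a b c where f': "f \<simeq> f'" and ab: "a \<in> {1..k}" "b \<in> {1..k}" "a \<noteq> b" "c \<notin> {a, b}"
    and pure: "a \<notin> f ` T" "b \<notin> f ` T" "roots \<inter> S \<noteq> {} \<Longrightarrow> c \<notin> f ` T"
    and f'ab: "\<And>v. v \<in> S \<Longrightarrow> v \<notin> roots \<Longrightarrow> f' v \<in> {a, b}"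
    and f'c: "\<And>r. r \<in> roots \<Longrightarrow> r \<in> S \<Longrightarrow> f' r = c" and f'T: "\<And>t. t \<in> T \<Longrightarrow> f' t = f t"
    by (rule normalize_S[OF f k uv]) blast
  obtain g' p q r where g': "g \<simeq> g'" and pq: "p \<noteq> q" "r \<notin> {p, q}"
    and pure': "p \<notin> g ` T" "q \<notin> g ` T" "roots \<inter> S \<noteq> {} \<Longrightarrow> r \<notin> g ` T"
    and g'pq: "\<And>v. v \<in> S \<Longrightarrow> v \<notin> roots \<Longrightarrow> g' v \<in> {p, q}"
    and g'r: "\<And>v. v \<in> roots \<Longrightarrow> v \<in> S \<Longrightarrow> g' v = r" and g'T: "\<And>t. t \<in> T \<Longrightarrow> g' t = g t"
    by (rule normalize_S[OF g k uv]) blast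
  \<comment> \<open>The 2-colouring given by \<open>g'\<close>, written in the colours
    \<open>a\<close> and \<open>b\<close> of \<open>f'\<close>.\<close>
  define \<sigma> where "\<sigma> v = (if g' v = p then a else b)" for v
  define h where "h = (\<lambda>v. if v \<in> S - roots then \<sigma> v else f' v)"
  have \<sigma>: "\<sigma> s = \<sigma> s' \<longleftrightarrow> g' s = g' s'" if "s \<in> S - roots" "s' \<in> S - roots" for s s'
    using g'pq[of s] g'pq[of s'] that ab(3) by (auto simp: \<sigma>_def)
  have f'h: "f' \<simeq> h"
    unfolding h_def
  proof (rule match[OF keq_col[OF f'] ab(1-3)])
    show "z \<in> S - roots" if "y \<in> S - roots" "{y, z} \<in> edges G" "f' z \<in> {a, b}" for y z
    proof -
      have "z \<notin> T"
      proof
        assume z: "z \<in> T"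
        then have "f' z \<in> f ` T" using f'T by simp
        then show False using that(3) pure(1,2) by (metis insertE singletonD)
      qed
      then have "z \<in> S" using edge_verts[OF that(2)] verts by blast
      moreover have "z \<notin> roots" using f'c[of z] \<open>z \<in> S\<close> that(3) ab(4) by auto
      ultimately show ?thesis by blast
    qed
    show "\<sigma> y \<noteq> \<sigma> z" if "y \<in> S - roots" "z \<in> S - roots" "{y, z} \<in> edges G" for y z
      using \<sigma>[OF that(1,2)] col_proper[OF keq_col[OF g'] that(3)] by simp
    show "f' v \<in> {a, b}" if "v \<in> S - roots" for v using f'ab that by blast
  qed (auto simp: verts \<sigma>_def)
  have hT: "h t = f t" if "t \<in> T" for t using that disj f'T by (auto simp: h_def)
  have hr: "h v = c" if "v \<in> S" "v \<in> roots" for v using f'c that by (simp add: h_def)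
  have h\<sigma>: "h v = \<sigma> v" if "v \<in> S" "v \<notin> roots" for v using that by (simp add: h_def)
  have "h s \<notin> f ` T" if "s \<in> S" for s
  proof (cases "s \<in> roots")
    case True
    then have "roots \<inter> S \<noteq> {}" using that by blast
    then show ?thesis using pure(3) hr[OF that True] by simp
  next
    case False
    then show ?thesis using pure(1,2) h\<sigma>[OF that False] by (simp add: \<sigma>_def)
  qed
  moreover have "h ` T = f ` T" using hT by simp
  ultimately have mh: "mixed h = {}" unfolding mixed_def by blast
  have "g' s \<notin> g ` T" if "s \<in> S" for s
  proof (cases "s \<in> roots")
    case True
    then have "roots \<inter> S \<noteq> {}" using that by blast
    then show ?thesis using pure'(3) g'r[OF True that] by simp
  next
    case False
    then show ?thesis using pure'(1,2) g'pq[OF that False] by (metis insertE singletonD)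
  qed
  moreover have "g' ` T = g ` T" using g'T by simp
  ultimately have mg: "mixed g' = {}" unfolding mixed_def by blast
  have "h s = h s' \<longleftrightarrow> g' s = g' s'" if s: "s \<in> S" "s' \<in> S" for s s'
  proof -
    have ne: "\<sigma> x \<noteq> c" "g' x \<noteq> r" if "x \<in> S" "x \<notin> roots" for x
      using ab(4) pq(2) g'pq[OF that] by (auto simp: \<sigma>_def)
    show ?thesis
    proof (cases "s \<in> roots"; cases "s' \<in> roots")
      assume "s \<in> roots" "s' \<in> roots"
      then show ?thesis using hr g'r s by simp
    next
      assume "s \<in> roots" "s' \<notin> roots"
      then show ?thesis using hr[OF s(1)] g'r[OF _ s(1)] h\<sigma>[OF s(2)] ne[OF s(2)] by metis
    next
      assume "s \<notin> roots" "s' \<in> roots"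
      then show ?thesis using hr[OF s(2)] g'r[OF _ s(2)] h\<sigma>[OF s(1)] ne[OF s(1)] by metis
    next
      assume "s \<notin> roots" "s' \<notin> roots"
      then show ?thesis using \<sigma>[of s s'] s h\<sigma> by simp
    qed
  qed
  then show ?thesis
    using keq_trans[OF f' f'h] g' mh mg hT g'T by (intro exI[of _ h] exI[of _ g']) simp
qed

text \<open>Align on \<open>S\<close>, then on \<open>T\<close> by the mirrored lemma, which leaves
  \<open>S\<close> unchanged. No colour is shared between the sides, so the two colourings induce
  the same partition of the vertices.\<close>

lemma split_equivalent:
  assumes f: "f \<in> colorings G k" "mixed f = {}" and g: "g \<in> colorings G k" "mixed g = {}" and k: "3 \<le> k"
  shows "f \<simeq> g"
proof -
  interpret M: almost_bipartite G k T S E by (rule mirror)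
  have mm: "M.mixed h = mixed h" for h by (auto simp: M.mixed_def mixed_def)
  obtain f1 g1 where 1: "f \<simeq> f1" "g \<simeq> g1" "mixed f1 = {}" "mixed g1 = {}"
    and S1: "\<forall>s\<in>S. \<forall>s'\<in>S. f1 s = f1 s' \<longleftrightarrow> g1 s = g1 s'"
    using align_S[OF f g k] by blast
  have "\<exists>f' g'. f1 \<simeq> f' \<and> g1 \<simeq> g' \<and> M.mixed f' = {} \<and> M.mixed g' = {} \<and>
    (\<forall>t\<in>S. f' t = f1 t \<and> g' t = g1 t) \<and> (\<forall>s\<in>T. \<forall>s'\<in>T. f' s = f' s' \<longleftrightarrow> g' s = g' s')"
    by (rule M.align_S[OF keq_col[OF 1(1)] _ keq_col[OF 1(2)] _ k]) (use 1 mm in simp_all)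
  then obtain f2 g2 where 2: "f1 \<simeq> f2" "g1 \<simeq> g2" "mixed f2 = {}" "mixed g2 = {}"
    and S2: "\<forall>t\<in>S. f2 t = f1 t \<and> g2 t = g1 t"
    and T2: "\<forall>s\<in>T. \<forall>s'\<in>T. f2 s = f2 s' \<longleftrightarrow> g2 s = g2 s'"
    unfolding mm by blast
  have cross: "h s \<noteq> h t" if "mixed h = {}" "s \<in> S" "t \<in> T" for h s t
    using that unfolding mixed_def by (metis disjoint_iff imageI)
  have "f2 \<simeq> g2"
  proof (rule same_partition[OF keq_col[OF 2(1)] keq_col[OF 2(2)]])
    show "f2 u = f2 v \<longleftrightarrow> g2 u = g2 v" if uv: "u \<in> verts G" "v \<in> verts G" for u v
    proof -
      consider "u \<in> S" "v \<in> S" | "u \<in> T" "v \<in> T" | "u \<in> S" "v \<in> T" | "u \<in> T" "v \<in> S"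
        using uv verts by blast
      then show ?thesis
      proof cases
        case 1
        then show ?thesis using S1 S2 by simp
      next
        case 2
        then show ?thesis using T2 by simp
      next
        case 3
        then show ?thesis using cross[OF 2(3)] cross[OF 2(4)] by simp
      next
        case 4
        then show ?thesis using cross[OF 2(3), of v u] cross[OF 2(4), of v u] by simp
      qed
    qed
  qed
  then show ?thesis
    using keq_trans[OF 1(1) keq_trans[OF 2(1)]] keq_sym[OF keq_trans[OF 1(2) 2(2)]] keq_trans by blast
qed

end

theorem theorem3:
  fixes B G :: "'a graph" and S T :: "'a set" and E :: "'a set set" and k l :: nat
  assumes "k \<ge> 4" and "l < k choose 2"
    and "BE_graph B S T E l G"
    and "colorable G (k - 1)"
    and "\<And>C. C \<in> components (edge_graph E) \<Longrightarrow>
           path_graph (induced (edge_graph E) C) \<or>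
           (\<exists>n\<ge>4. cycle_graph n (induced (edge_graph E) C)) \<or>
           complete_bipartite (induced (edge_graph E) C)"
  shows "Kc G k = 1"
proof -
  have B: "simple_graph B" "bipartition B S T" and cE: "card E = l"
    and E: "\<And>e. e \<in> E \<Longrightarrow> e \<subseteq> S \<or> e \<subseteq> T"
    and G: "verts G = verts B" "edges G = edges B \<union> E"
    using assms(3) unfolding BE_graph_def by (auto 0 3)
  have ST: "verts B = S \<union> T" "S \<inter> T = {}" and cross: "\<And>e. e \<in> edges B \<Longrightarrow> \<exists>s\<in>S. \<exists>t\<in>T. e = {s, t}"
    using B(2) by (auto simp: bipartition_def)
  interpret almost_bipartite G k S T E
  proof
    show "simple_graph G" using BE_graph_simple[OF assms(3)] .
    show "e \<in> E" if "e \<in> edges G" "e \<subseteq> S \<or> e \<subseteq> T" for e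
    proof (rule ccontr)
      assume "e \<notin> E"
      then have "e \<in> edges B" using that(1) G(2) by simp
      from cross[OF this] obtain s t where "s \<in> S" "t \<in> T" "e = {s, t}" by blast
      then show False using that(2) ST(2) by auto
    qed
    show "verts G = S \<union> T" "S \<inter> T = {}" "E \<subseteq> edges G" using G ST by simp_all
    show "e \<subseteq> S \<or> e \<subseteq> T" if "e \<in> E" for e using E[OF that] .
  qed (rule assms(5))
  let ?X = "colorings G k"
  have few: "card E < k choose 2" using cE assms(2) by simp
  have eq: "f \<simeq> g" if fg: "f \<in> ?X" "g \<in> ?X" for f g
  proof -
    obtain f' where f': "f \<simeq> f'" "mixed f' = {}" by (rule ex_split[OF assms(1,4) few fg(1)])
    obtain g' where g': "g \<simeq> g'" "mixed g' = {}" by (rule ex_split[OF assms(1,4) few fg(2)])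
    have "f' \<simeq> g'"
      using split_equivalent[OF keq_col[OF f'(1)] f'(2) keq_col[OF g'(1)] g'(2)] assms(1) by simp
    then show ?thesis using keq_trans[OF f'(1)] keq_trans keq_sym[OF g'(1)] by blast
  qed
  \<comment> \<open>A colouring with \<open>k - 1\<close> colours is also one with \<open>k\<close>
    colours, so there is at least one class.\<close>
  obtain f where f: "f \<in> ?X"
    using assms(4) colorings_mono[of "k - 1" k G] by (auto simp: colorable_def)
  have "?X // kempe_equivalence G k = {?X}"
  proof -
    have "kempe_equivalence G k `` {g} = ?X" if "g \<in> ?X" for g
      using eq[OF that] keq_col by blast
    then show ?thesis using f by (auto simp: quotient_def)
  qed
  then show ?thesis by (simp add: Kc_def)
qed

end
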